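(* Consider the state-control model of the context (infinite-capacity system, $m$ classes with rates $\lambda_i,\mu_i$, $\rho_i=\lambda_i/\mu_i$, target polytope $\mathcal S=\{\mathbf x:\mathbf 0\le\mathbf x\le\boldsymbol\rho,\ \mathbf D\mathbf x\le\mathbf h\}$ with $\mathbf D\in\mathbf R^{s\times m}$, $\mathbf h\in\mathbf R_+^s$) under the penalty policy $\tilde{\boldsymbol\pi}$ with multiplier $\beta$. Suppose $0<\varepsilon<\frac14$, that $\beta$ satisfies $$\beta\le\varepsilon\Big(\min_{1\le j\le s}\{h_j+\mathbf d_j^-\boldsymbol\rho\}\Big),$$ and that $\mathbf E[\Psi(\tilde{\mathbf s}(0))]\le\Psi^*$. Suppose also that $\mu_{\min}/\mu_{\max}\ge\gamma^*$, where $\mu_{\min}=\min_{1\le i\le m}\mu_i$ and $\mu_{\max}=\max_{1\le i\le m}\mu_i$. Then $$\mathbf E[\Psi(\tilde{\mathbf s}(t))]\le\Psi^*\qquad\text{for all }t\ge0.$$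
   Context: State-control model. Requests of $m$ classes arrive in independent Poisson streams of rates $\lambda_i$ to a common infinite-capacity system; class $i$ service durations are $\exp(\mu_i)$; $\boldsymbol\rho=(\rho_1,\dots,\rho_m)^T$ with $\rho_i=\lambda_i/\mu_i$. Each arriving request is accepted or rejected on arrival. $\mathcal S=\{\mathbf x:\mathbf 0\le\mathbf x\le\boldsymbol\rho,\ \mathbf D\mathbf x\le\mathbf h\}$ is a polytope with $\mathbf D\in\mathbf R^{s\times m}$, $\mathbf h\ge\mathbf 0$, and its interior is assumed nonempty, in the sense that there is $\mathbf x\in\mathcal S$ with $\mathbf D\mathbf x<\mathbf h$ (componentwise). Write $\mathbf D^+,\mathbf D^-$ for the matrices with entries $\max\{D_{ji},0\}$ and $\max\{-D_{ji},0\}$, with $j$th rows $\mathbf d_j^+,\mathbf d_j^-$. The lifted set is $$\tilde{\mathcal S}=\{(\mathbf x,\mathbf y):\mathbf 0\le\mathbf x\le\boldsymbol\rho,\ \mathbf 0\le\mathbf y\le\boldsymbol\rho,\ \mathbf D^+\mathbf x+\mathbf D^-\mathbf y\le\mathbf h+\mathbf D^-\boldsymbol\rho\}.$$ Define $$(\mathbf x^*,\mathbf y^* )=\arg\min_{(\mathbf x,\mathbf y)\in\tilde{\mathcal S}}\ \max_{1\le j\le s}\Big\{\frac{\mathbf d_j^+\mathbf x+\mathbf d_j^-\mathbf y}{h_j+\mathbf d_j^-\boldsymbol\rho}\Big\},$$ and let $\gamma^*$ be the minimum value. The penalty function is $$\Psi(\mathbf x,\mathbf y)=\sum_{j=1}^s\exp\Big(\beta\cdot\frac{\mathbf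 d_j^+\mathbf x+\mathbf d_j^-\mathbf y}{h_j+\mathbf d_j^-\boldsymbol\rho}\Big),\qquad\Psi^*=\Psi\Big(\frac{(1+3\varepsilon)\mu_{\max}}{\mu_{\min}}(\mathbf x^*,\mathbf y^* )\Big).$$ Policy $\tilde{\boldsymbol\pi}$. A fictitious infinite-capacity system tracks rejected requests; $\tilde{\mathbf s}(t)=(\tilde{\mathbf x}(t),\tilde{\mathbf y}(t))$ is the vector of numbers of requests of each class in the original and fictitious systems at time $t$. Requests present initially have $\exp(\mu_i)$ service times. An arriving class $i$ request is accepted if $\frac{\partial\Psi}{\partial x_i}\le\frac{\partial\Psi}{\partial y_i}$ at the current state; otherwise it is routed to the fictitious system with an $\exp(\mu_i)$ service time independent of everything else.
   Formalization: The minimum defining (x*,y* ) and γ* is taken over points of the lifted set with x+y=ρ (otherwise (0,0) is optimal and the claim fails); the entries of D are assumed to satisfy |D_ji|≤1 (otherwise rescaling the rows voids the bound on β); and β≥0 is assumed. *)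

theory Defs
  imports "HOL-Probability.Probability"
begin

section \<open>The target polytope and its lifting\<close>

definition pos_part :: "real^'m^'s \<Rightarrow> real^'m^'s" where
  "pos_part D = (\<chi> j i. max (D $ j $ i) 0)"

definition neg_part :: "real^'m^'s \<Rightarrow> real^'m^'s" where
  "neg_part D = (\<chi> j i. max (- D $ j $ i) 0)"

definition offered_load :: "real^'m \<Rightarrow> real^'m \<Rightarrow> real^'m" where
  "offered_load lam mu = (\<chi> i. lam $ i / mu $ i)"

definition target_set :: "real^'m^'s \<Rightarrow> real^'s \<Rightarrow> real^'m \<Rightarrow> (real^'m) set" where
  "target_set D h \<rho> =
     {x. (\<forall>i. 0 \<le> x $ i \<and> x $ i \<le> \<rho> $ i) \<and> (\<forall>j. (D *v x) $ j \<le> h $ j)}"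

text \<open>
  \<open>x\<close> lies in the target set iff \<open>(x, \<rho> - x)\<close> lies in the lifted set. The lifted set itself does
  not impose \<open>x + y = \<rho>\<close>: it contains \<open>(0, 0)\<close>, so this constraint has to be added when
  minimizing over it.
\<close>

definition lifted_set :: "real^'m^'s \<Rightarrow> real^'s \<Rightarrow> real^'m \<Rightarrow> ((real^'m) \<times> (real^'m)) set" where
  "lifted_set D h \<rho> =
     {(x, y). (\<forall>i. 0 \<le> x $ i \<and> x $ i \<le> \<rho> $ i) \<and> (\<forall>i. 0 \<le> y $ i \<and> y $ i \<le> \<rho> $ i) \<and>
        (\<forall>j. (pos_part D *v x + neg_part D *v y) $ j \<le> (h + neg_part D *v \<rho>) $ j)}"

definition capacity :: "real^'m^'s \<Rightarrow> real^'s \<Rightarrow> real^'m \<Rightarrow> 's \<Rightarrow> real" where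
  "capacity D h \<rho> j = (h + neg_part D *v \<rho>) $ j"

definition utilization ::
    "real^'m^'s \<Rightarrow> real^'s \<Rightarrow> real^'m \<Rightarrow> (real^'m) \<times> (real^'m) \<Rightarrow> 's \<Rightarrow> real" where
  "utilization D h \<rho> p j =
     (pos_part D *v fst p + neg_part D *v snd p) $ j / capacity D h \<rho> j"

definition max_utilization ::
    "real^'m^'s \<Rightarrow> real^'s \<Rightarrow> real^'m \<Rightarrow> (real^'m) \<times> (real^'m) \<Rightarrow> real" where
  "max_utilization D h \<rho> p = Max (range (utilization D h \<rho> p))"

definition penalty ::
    "real \<Rightarrow> real^'m^'s \<Rightarrow> real^'s \<Rightarrow> real^'m \<Rightarrow> (real^'m) \<times> (real^'m) \<Rightarrow> real" where
  "penalty \<beta> D h \<rho> p = (\<Sum>j\<in>UNIV. exp (\<beta> * utilization D h \<rho> p j))"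

definition partial_x :: "((real^'m) \<times> (real^'m) \<Rightarrow> real) \<Rightarrow> (real^'m) \<times> (real^'m) \<Rightarrow> 'm \<Rightarrow> real" where
  "partial_x F p i = deriv (\<lambda>u. F (fst p + u *\<^sub>R axis i 1, snd p)) 0"

definition partial_y :: "((real^'m) \<times> (real^'m) \<Rightarrow> real) \<Rightarrow> (real^'m) \<times> (real^'m) \<Rightarrow> 'm \<Rightarrow> real" where
  "partial_y F p i = deriv (\<lambda>u. F (fst p, snd p + u *\<^sub>R axis i 1)) 0"


section \<open>The stochastic model\<close>

datatype sys = Original | Fictitious

text \<open>
  The exponential clocks driving the model. \<open>Interarrival i n\<close> is the time between the
  arrivals number \<open>n - 1\<close> and \<open>n\<close> of class \<open>i\<close> (arrivals are numbered from 0, and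
  \<open>Interarrival i 0\<close> is measured from time 0). \<open>Service q i n\<close> is the service time of arrival
  \<open>n\<close> of class \<open>i\<close> if it is sent to the system \<open>q\<close>. \<open>Residual q i k\<close> is the service time of
  request \<open>k\<close> among the class \<open>i\<close> requests present in \<open>q\<close> at time 0.
\<close>

datatype 'm clock =
    Interarrival 'm nat
  | Service sys 'm nat
  | Residual sys 'm nat

fun clock_rate :: "real^'m \<Rightarrow> real^'m \<Rightarrow> 'm clock \<Rightarrow> real" where
  "clock_rate lam mu (Interarrival i n) = lam $ i"
| "clock_rate lam mu (Service q i n) = mu $ i"
| "clock_rate lam mu (Residual q i k) = mu $ i"

text \<open>
  The initial numbers of requests \<open>N \<omega> q i\<close> have an arbitrary joint law. The function type is
  countable since \<open>sys\<close> and \<open>'m\<close> are finite, so \<open>count_space\<close> is its natural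
  \<open>\<sigma>\<close>-algebra.
\<close>

definition driving_clocks ::
    "'a measure \<Rightarrow> real^'m \<Rightarrow> real^'m \<Rightarrow> ('m clock \<Rightarrow> 'a \<Rightarrow> real) \<Rightarrow>
     ('a \<Rightarrow> sys \<Rightarrow> 'm \<Rightarrow> nat) \<Rightarrow> bool" where
  "driving_clocks M lam mu W N \<longleftrightarrow>
     prob_space M \<and>
     (\<forall>c. distributed M lborel (W c) (\<lambda>t. ennreal (exponential_density (clock_rate lam mu c) t))) \<and>
     prob_space.indep_vars M (\<lambda>_. borel) W UNIV \<and>
     N \<in> measurable M (count_space UNIV) \<and>
     prob_space.indep_set M
       (sets (vimage_algebra (space M) N (count_space UNIV)))
       (sets (vimage_algebra (space M) (\<lambda>\<omega> c. W c \<omega>) (Pi\<^sub>M UNIV (\<lambda>_. borel))))"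

definition arrival_time :: "('m clock \<Rightarrow> 'a \<Rightarrow> real) \<Rightarrow> 'm \<Rightarrow> nat \<Rightarrow> 'a \<Rightarrow> real" where
  "arrival_time W i n \<omega> = (\<Sum>l\<le>n. W (Interarrival i l) \<omega>)"

text \<open>
  \<open>R i n \<omega>\<close> is the system to which arrival \<open>n\<close> of class \<open>i\<close> is sent. A request is present on
  the half-open interval from its arrival (included) to its departure (excluded), so that
  \<open>num_present\<close> is right-continuous in \<open>t\<close>; \<open>num_before\<close> is its left limit. Almost surely the
  sets counted are finite.
\<close>

definition num_present ::
    "('m clock \<Rightarrow> 'a \<Rightarrow> real) \<Rightarrow> ('a \<Rightarrow> sys \<Rightarrow> 'm \<Rightarrow> nat) \<Rightarrow> ('m \<Rightarrow> nat \<Rightarrow> 'a \<Rightarrow> sys) \<Rightarrow>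
     sys \<Rightarrow> 'm \<Rightarrow> real \<Rightarrow> 'a \<Rightarrow> nat" where
  "num_present W N R q i t \<omega> =
     card {k. k < N \<omega> q i \<and> t < W (Residual q i k) \<omega>} +
     card {n. R i n \<omega> = q \<and> arrival_time W i n \<omega> \<le> t \<and>
              t < arrival_time W i n \<omega> + W (Service q i n) \<omega>}"

definition num_before ::
    "('m clock \<Rightarrow> 'a \<Rightarrow> real) \<Rightarrow> ('a \<Rightarrow> sys \<Rightarrow> 'm \<Rightarrow> nat) \<Rightarrow> ('m \<Rightarrow> nat \<Rightarrow> 'a \<Rightarrow> sys) \<Rightarrow>
     sys \<Rightarrow> 'm \<Rightarrow> real \<Rightarrow> 'a \<Rightarrow> nat" where
  "num_before W N R q i t \<omega> =
     card {k. k < N \<omega> q i \<and> t \<le> W (Residual q i k) \<omega>} +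
     card {n. R i n \<omega> = q \<and> arrival_time W i n \<omega> < t \<and>
              t \<le> arrival_time W i n \<omega> + W (Service q i n) \<omega>}"

definition state ::
    "('m clock \<Rightarrow> 'a \<Rightarrow> real) \<Rightarrow> ('a \<Rightarrow> sys \<Rightarrow> 'm \<Rightarrow> nat) \<Rightarrow> ('m \<Rightarrow> nat \<Rightarrow> 'a \<Rightarrow> sys) \<Rightarrow>
     real \<Rightarrow> 'a \<Rightarrow> (real^'m) \<times> (real^'m)" where
  "state W N R t \<omega> =
     ((\<chi> i. real (num_present W N R Original i t \<omega>)),
      (\<chi> i. real (num_present W N R Fictitious i t \<omega>)))"

definition state_before ::
    "('m clock \<Rightarrow> 'a \<Rightarrow> real) \<Rightarrow> ('a \<Rightarrow> sys \<Rightarrow> 'm \<Rightarrow> nat) \<Rightarrow> ('m \<Rightarrow> nat \<Rightarrow> 'a \<Rightarrow> sys) \<Rightarrow>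
     real \<Rightarrow> 'a \<Rightarrow> (real^'m) \<times> (real^'m)" where
  "state_before W N R t \<omega> =
     ((\<chi> i. real (num_before W N R Original i t \<omega>)),
      (\<chi> i. real (num_before W N R Fictitious i t \<omega>)))"

text \<open>
  The routing decisions follow the policy with potential \<open>F\<close> (ties are accepted). The state found
  by an arrival involves only the decisions for strictly earlier arrivals, of which there are almost
  surely finitely many; so the condition determines \<open>R\<close> recursively, up to a null set.
\<close>

definition follows_policy ::
    "'a measure \<Rightarrow> ((real^'m) \<times> (real^'m) \<Rightarrow> real) \<Rightarrow> ('m clock \<Rightarrow> 'a \<Rightarrow> real) \<Rightarrow>
     ('a \<Rightarrow> sys \<Rightarrow> 'm \<Rightarrow> nat) \<Rightarrow> ('m \<Rightarrow> nat \<Rightarrow> 'a \<Rightarrow> sys) \<Rightarrow> bool" where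
  "follows_policy M F W N R \<longleftrightarrow>
     (\<forall>i n. R i n \<in> measurable M (count_space UNIV)) \<and>
     (AE \<omega> in M. \<forall>i n.
        let p = state_before W N R (arrival_time W i n \<omega>) \<omega>
        in R i n \<omega> = (if partial_x F p i \<le> partial_y F p i then Original else Fictitious))"

end

theory Submission
  imports Defs
begin

text \<open>
  Under the policy, the generator of the chain satisfies \<open>L \<Psi> \<le> c * (\<Psi>s - \<Psi>)\<close> with
  \<open>c = mu_min * (1 - \<epsilon> / 2)\<close>; this is \<open>exp_penalty_drift\<close>. By the bound on \<open>\<beta>\<close>, one request changes
  every exponent of \<open>\<Psi>\<close> by at most \<open>\<epsilon>\<close>, so jumps of \<open>\<Psi>\<close> are close to its partial derivatives. The
  policy always chooses the smaller derivative, and therefore does at least as well as the static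
  split of the arrivals in the proportions \<open>xs\<close> and \<open>ys\<close>; as \<open>xs + ys = \<rho>\<close>, that split balances
  the departures at the point \<open>(xs, ys)\<close>. What remains is the derivative of \<open>\<Psi>\<close> at the current state
  in the direction of a multiple of \<open>(xs, ys)\<close>, and \<open>\<Psi>\<close> is convex. Formally, the mean \<open>u\<close> of \<open>\<Psi>\<close> then
  satisfies \<open>u' \<le> c * (\<Psi>s - u)\<close> and cannot cross the level \<open>\<Psi>s\<close> upwards.

  Most of the work is to justify this differential inequality for the process built from the
  exponential clocks. It is done one clock at a time. When all clocks but one are fixed, the jump
  which the remaining clock would cause at time \<open>t\<close>, if it is still running, does not depend on its
  value. As an exponential clock has a constant hazard rate, the expected jump at its ring
  equals the expected integral, over the time it runs, of its rate times that potential
  jump (\<open>compensator\<close>). Summing over all clocks turns the telescoping sum of jumps along a path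
  (\<open>after_telescope\<close>) into an integral of the generator (\<open>mean_increment\<close>).

  To have only finitely many clocks and bounded populations, the arrivals of each class are cut off
  after the first \<open>K\<close>, and the initial population is fixed. The drift inequality survives because
  arrivals only increase \<open>\<Psi>\<close>. The resulting estimate (\<open>mean_bound\<close>) is averaged over the initial law and
  carried over to the original process by Fatou's lemma (\<open>lyapunov_bound\<close>).
\<close>

section \<open>Exponential clocks and their compensators\<close>

text \<open>
  Replacing one coordinate by an independent copy does not change the law of the family. So one
  clock can be integrated out while all the others, including those whose start depends on it,
  keep their values.
\<close>

lemma (in product_prob_space) nn_integral_resample:
  assumes f[measurable]: "f \<in> borel_measurable (PiM UNIV M)"
  shows "(\<integral>\<^sup>+w. f w \<partial>PiM UNIV M) = (\<integral>\<^sup>+w. (\<integral>\<^sup>+v. f (w(c := v)) \<partial>M c) \<partial>PiM UNIV M)"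
proof -
  let ?Q = "PiM (UNIV - {c}) M"
  interpret Q: prob_space ?Q
    by (intro prob_space_PiM prob_space)
  interpret pair_sigma_finite "M c" ?Q ..
  have upd[measurable]: "(\<lambda>(v, x). x(c := v)) \<in> measurable (M c \<Otimes>\<^sub>M ?Q) (PiM UNIV M)"
  proof -
    have "(\<lambda>p. (snd p)(c := fst p)) \<in> measurable (M c \<Otimes>\<^sub>M ?Q) (PiM UNIV M)"
      by (rule measurable_fun_upd[where J="UNIV - {c}"]) auto
    then show ?thesis by (simp add: case_prod_unfold)
  qed
  have P: "PiM UNIV M = distr (M c \<Otimes>\<^sub>M ?Q) (PiM UNIV M) (\<lambda>(v, x). x(c := v))"
    using distr_pair_PiM_eq_PiM[of "UNIV - {c}" M c] by (simp add: prob_space insert_absorb)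
  have split: "(\<integral>\<^sup>+w. g w \<partial>PiM UNIV M) = (\<integral>\<^sup>+v. (\<integral>\<^sup>+x. g (x(c := v)) \<partial>?Q) \<partial>M c)"
    if [measurable]: "g \<in> borel_measurable (PiM UNIV M)" for g
    by (subst P, subst nn_integral_distr)
       (auto simp: Q.nn_integral_fst[symmetric] case_prod_unfold)
  have upd2[measurable]: "(\<lambda>p. (fst p)(c := snd p)) \<in> measurable (PiM UNIV M \<Otimes>\<^sub>M M c) (PiM UNIV M)"
    by (rule measurable_fun_upd[where J="UNIV"]) auto
  have meas: "(\<lambda>w. \<integral>\<^sup>+v. f (w(c := v)) \<partial>M c) \<in> borel_measurable (PiM UNIV M)"
    using measurable_compose[OF upd2 f] by (intro M.borel_measurable_nn_integral) (simp add: case_prod_unfold)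
  have "(\<integral>\<^sup>+w. (\<integral>\<^sup>+v. f (w(c := v)) \<partial>M c) \<partial>PiM UNIV M)
      = (\<integral>\<^sup>+v'. (\<integral>\<^sup>+x. (\<integral>\<^sup>+v. f (x(c := v)) \<partial>M c) \<partial>?Q) \<partial>M c)"
    by (subst split[OF meas]) simp
  also have "\<dots> = (\<integral>\<^sup>+x. (\<integral>\<^sup>+v. f (x(c := v)) \<partial>M c) \<partial>?Q)"
    by (simp add: prob_space.emeasure_space_1[OF prob_space])
  also have "\<dots> = (\<integral>\<^sup>+v. (\<integral>\<^sup>+x. f (x(c := v)) \<partial>?Q) \<partial>M c)"
    using measurable_compose[OF upd f] by (intro Fubini') (simp add: case_prod_unfold)
  also have "\<dots> = (\<integral>\<^sup>+w. f w \<partial>PiM UNIV M)"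
    by (rule split[OF f, symmetric])
  finally show ?thesis ..
qed

abbreviation exp_law :: "real \<Rightarrow> real measure" where
  "exp_law r \<equiv> density lborel (\<lambda>x. ennreal (exponential_density r x))"

lemma emeasure_exp_law_ge:
  assumes r: "0 < r" and x: "0 \<le> x"
  shows "emeasure (exp_law r) {x..} = ennreal (exp (- x * r))"
proof -
  interpret prob_space "exp_law r" by (rule prob_space_exponential_density[OF r])
  have D: "distributed (exp_law r) lborel (\<lambda>x. x) (exponential_density r)"
    by (auto simp: distributed_def distr_id2 intro!: distr_id2)
  have "emeasure (exp_law r) {x..} = emeasure (exp_law r) {x<..}"
  proof (rule emeasure_eq_AE)
    have "AE y in lborel. y \<noteq> x" by (rule AE_lborel_singleton)
    then show "AE y in exp_law r. (y \<in> {x..}) = (y \<in> {x<..})"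
      by (auto simp: AE_density elim: eventually_mono)
  qed auto
  also have "\<dots> = ennreal (exp (- x * r))"
    using exponential_distributedD_gt[OF D x r] by (simp add: emeasure_eq_measure greaterThan_def)
  finally show ?thesis .
qed

lemma AE_exp_law_pos: "0 < r \<Longrightarrow> AE v in exp_law r. 0 < v"
proof -
  have "AE v in lborel. v \<noteq> (0::real)" by (rule AE_lborel_singleton)
  then show ?thesis
    by (auto simp: AE_density exponential_density_def elim!: eventually_mono)
qed

lemma AE_exp_law_neq: "AE v in exp_law r. v \<noteq> a"
proof -
  have "AE v in lborel. v \<noteq> a" by (rule AE_lborel_singleton)
  then show ?thesis
    by (auto simp: AE_density elim!: eventually_mono)
qed

text \<open>
  The hazard rate of an exponential variable is constant: its density at \<open>u\<close> is \<open>r\<close> times the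
  probability of surviving up to \<open>u\<close>. By Tonelli, collecting \<open>g\<close> once at the time when the clock
  rings therefore has the same mean as collecting it at rate \<open>r\<close> for as long as the clock runs.
\<close>

lemma exp_law_compensator:
  assumes r: "0 < r" and g[measurable]: "g \<in> borel_measurable borel"
  shows "(\<integral>\<^sup>+v. g v \<partial>exp_law r) =
    (\<integral>\<^sup>+v. (\<integral>\<^sup>+u. indicator {0<..v} u * (ennreal r * g u) \<partial>lborel) \<partial>exp_law r)"
proof -
  interpret E: prob_space "exp_law r" by (rule prob_space_exponential_density[OF r])
  interpret pair_sigma_finite lborel "exp_law r" ..
  have "(\<integral>\<^sup>+v. (\<integral>\<^sup>+u. indicator {0<..v} u * (ennreal r * g u) \<partial>lborel) \<partial>exp_law r)
     = (\<integral>\<^sup>+u. (\<integral>\<^sup>+v. indicator {0<..v} u * (ennreal r * g u) \<partial>exp_law r) \<partial>lborel)"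
  proof (rule Fubini')
    have "(\<lambda>x::real\<times>real. if 0 < fst x \<and> fst x \<le> snd x then ennreal r * g (fst x) else 0)
        \<in> borel_measurable (borel \<Otimes>\<^sub>M borel)"
      by measurable
    also have "(\<lambda>x::real\<times>real. if 0 < fst x \<and> fst x \<le> snd x then ennreal r * g (fst x) else 0)
        = (\<lambda>(x, y). indicator {0<..y} x * (ennreal r * g x))"
      by (auto simp: fun_eq_iff indicator_def)
    finally show "(\<lambda>(x, y). indicator {0<..y} x * (ennreal r * g x)) \<in> borel_measurable (lborel \<Otimes>\<^sub>M exp_law r)"
      by (simp cong: measurable_cong_sets)
  qed
  also have "\<dots> = (\<integral>\<^sup>+u. g u * ennreal (exponential_density r u) \<partial>lborel)"
  proof (rule nn_integral_cong_AE)
    have "AE u in lborel. u \<noteq> (0::real)" by (rule AE_lborel_singleton)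
    then show "AE u in lborel. (\<integral>\<^sup>+v. indicator {0<..v} u * (ennreal r * g u) \<partial>exp_law r)
       = g u * ennreal (exponential_density r u)"
    proof eventually_elim
      case (elim u)
      show ?case
      proof (cases "0 < u")
        case True
        have "(\<integral>\<^sup>+v. indicator {0<..v} u * (ennreal r * g u) \<partial>exp_law r)
          = (\<integral>\<^sup>+v. (ennreal r * g u) * indicator {u..} v \<partial>exp_law r)"
          using True by (intro nn_integral_cong) (auto simp: indicator_def)
        also have "\<dots> = (ennreal r * g u) * ennreal (exp (- u * r))"
          using True r by (simp add: nn_integral_cmult_indicator emeasure_exp_law_ge)
        finally show ?thesis
          using True r by (simp add: exponential_density_def ennreal_mult' ac_simps)
      next
        case False
        with elim show ?thesis by (simp add: exponential_density_def indicator_def)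
      qed
    qed
  qed
  also have "\<dots> = (\<integral>\<^sup>+v. g v \<partial>exp_law r)"
    by (simp add: nn_integral_density ac_simps)
  finally show ?thesis ..
qed

locale exp_clocks =
  fixes r :: "'c::countable \<Rightarrow> real"
  assumes r_pos: "0 < r c"
begin

text \<open>
  The law of the clocks on their canonical space of functions from clocks to reals.
\<close>

definition P :: "('c \<Rightarrow> real) measure" where
  "P = PiM UNIV (\<lambda>c. exp_law (r c))"

sublocale product_prob_space "\<lambda>c. exp_law (r c)" UNIV
  by (intro product_prob_spaceI prob_space_exponential_density r_pos)

sublocale clk: prob_space P
  unfolding P_def by unfold_locales

lemma sets_P[measurable_cong]: "sets P = sets (PiM UNIV (\<lambda>_. borel))"
  unfolding P_def by (intro sets_PiM_cong) auto

lemma space_P[simp]: "space P = UNIV"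
  by (simp add: P_def space_PiM)

lemma clock_measurable[measurable]: "(\<lambda>w. w c) \<in> borel_measurable P"
  by (simp cong: measurable_cong_sets add: sets_P)

lemma resample_measurable[measurable]: "(\<lambda>(w, v). w(c := v)) \<in> measurable (P \<Otimes>\<^sub>M borel) P"
proof -
  have "(\<lambda>p. (fst p)(c := snd p)) \<in> measurable (PiM UNIV (\<lambda>_. borel::real measure) \<Otimes>\<^sub>M borel) (PiM UNIV (\<lambda>_. borel))"
    by (rule measurable_fun_upd[where J="UNIV"]) auto
  then show ?thesis by (simp add: case_prod_unfold cong: measurable_cong_sets)
qed

lemma AE_pos: "AE w in P. \<forall>c. 0 < w c"
  unfolding AE_all_countable P_def
  by (intro allI AE_component AE_exp_law_pos r_pos) simp

lemma nn_integral_resample_P: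
  assumes "f \<in> borel_measurable P"
  shows "(\<integral>\<^sup>+w. f w \<partial>P) = (\<integral>\<^sup>+w. (\<integral>\<^sup>+v. f (w(c := v)) \<partial>exp_law (r c)) \<partial>P)"
  using nn_integral_resample[of f c] assms by (simp add: P_def)

text \<open>
  Assume that \<open>f w u\<close> depends on the clock \<open>c\<close> only through the fact that \<open>c\<close> has not rung before
  age \<open>u\<close>. Once the other clocks are fixed, \<open>f\<close> is then a deterministic function of the age alone, and
  the identity for one exponential variable applies. This one-clock argument replaces the
  Markov property: no conditioning on the history of the process is needed.
\<close>

lemma compensator_age:
  assumes f: "(\<lambda>(w, u). f w u) \<in> borel_measurable (P \<Otimes>\<^sub>M borel)"
    and nonant: "\<And>w u v. (\<forall>c. 0 < w c) \<Longrightarrow> 0 < u \<Longrightarrow> u \<le> w c \<Longrightarrow> u \<le> v \<Longrightarrow> f (w(c := v)) u = f w u"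
  shows "(\<integral>\<^sup>+w. f w (w c) \<partial>P) =
    (\<integral>\<^sup>+w. (\<integral>\<^sup>+u. indicator {0<..w c} u * (ennreal (r c) * f w u) \<partial>lborel) \<partial>P)"
proof -
  have f'[measurable (raw)]: "(\<lambda>x. f (a x) (b x)) \<in> borel_measurable M"
    if "a \<in> measurable M P" "b \<in> borel_measurable M" for a b M
    using measurable_compose[OF measurable_Pair[OF that] f] by simp
  have upd'[measurable (raw)]: "(\<lambda>x. (a x)(c := b x)) \<in> measurable M P"
    if "a \<in> measurable M P" "b \<in> borel_measurable M" for a b M
    using measurable_compose[OF measurable_Pair[OF that] resample_measurable] by simp
  have ind: "(\<lambda>x. indicator {0<..fst x c} (snd x) * (ennreal (r c) * f (fst x) (snd x)))
      \<in> borel_measurable (P \<Otimes>\<^sub>M lborel)"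
  proof -
    have "(\<lambda>x. if 0 < snd x \<and> snd x \<le> fst x c then ennreal (r c) * f (fst x) (snd x) else 0)
      \<in> borel_measurable (P \<Otimes>\<^sub>M lborel)"
      by measurable
    also have "(\<lambda>x. if 0 < snd x \<and> snd x \<le> fst x c then ennreal (r c) * f (fst x) (snd x) else 0)
      = (\<lambda>x. indicator {0<..fst x c} (snd x) * (ennreal (r c) * f (fst x) (snd x)))"
      by (auto simp: fun_eq_iff indicator_def)
    finally show ?thesis .
  qed
  have "(\<integral>\<^sup>+w. (\<integral>\<^sup>+u. indicator {0<..w c} u * (ennreal (r c) * f w u) \<partial>lborel) \<partial>P)
    = (\<integral>\<^sup>+w. (\<integral>\<^sup>+v. (\<integral>\<^sup>+u. indicator {0<..v} u * (ennreal (r c) * f (w(c := v)) u) \<partial>lborel)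
          \<partial>exp_law (r c)) \<partial>P)"
    using ind by (subst nn_integral_resample_P[where c=c])
      (auto intro!: lborel.borel_measurable_nn_integral simp: case_prod_unfold)
  also have "\<dots> = (\<integral>\<^sup>+w. (\<integral>\<^sup>+v. f (w(c := v)) v \<partial>exp_law (r c)) \<partial>P)"
  proof (rule nn_integral_cong_AE)
    show "AE w in P. (\<integral>\<^sup>+v. (\<integral>\<^sup>+u. indicator {0<..v} u * (ennreal (r c) * f (w(c := v)) u) \<partial>lborel)
          \<partial>exp_law (r c)) = (\<integral>\<^sup>+v. f (w(c := v)) v \<partial>exp_law (r c))"
      using AE_pos
    proof eventually_elim
      case (elim w)
      have *: "f (w(c := v)) u = f (w(c := u)) u" if "0 < u" "u \<le> v" for u v
        using nonant[of "w(c := u)" u v] that elim by auto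
      have "(\<integral>\<^sup>+v. (\<integral>\<^sup>+u. indicator {0<..v} u * (ennreal (r c) * f (w(c := v)) u) \<partial>lborel) \<partial>exp_law (r c))
        = (\<integral>\<^sup>+v. (\<integral>\<^sup>+u. indicator {0<..v} u * (ennreal (r c) * f (w(c := u)) u) \<partial>lborel) \<partial>exp_law (r c))"
        proof (intro nn_integral_cong)
        fix v u
        show "indicator {0<..v} u * (ennreal (r c) * f (w(c := v)) u)
          = indicator {0<..v} u * (ennreal (r c) * f (w(c := u)) u)"
          using *[of u v] by (auto simp: indicator_def)
      qed
      also have "\<dots> = (\<integral>\<^sup>+v. f (w(c := v)) v \<partial>exp_law (r c))"
        by (rule exp_law_compensator[symmetric, OF r_pos]) measurable
      finally show ?case .
    qed
  qed
  also have "\<dots> = (\<integral>\<^sup>+w. f w (w c) \<partial>P)"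
    by (subst nn_integral_resample_P[where c=c and f="\<lambda>w. f w (w c)"]) simp_all
  finally show ?thesis ..
qed

text \<open>
  The same identity in calendar time, for a clock that starts at a time \<open>S w\<close> fixed by the other
  clocks.
\<close>

lemma compensator_nn:
  assumes S[measurable]: "S \<in> borel_measurable P"
    and S_indep: "\<And>w v. S (w(c := v)) = S w"
    and G: "(\<lambda>(w, t). G w t) \<in> borel_measurable (P \<Otimes>\<^sub>M borel)"
    and nonant: "\<And>w t v. (\<forall>c. 0 < w c) \<Longrightarrow> S w < t \<Longrightarrow> t \<le> S w + w c \<Longrightarrow> t \<le> S w + v
      \<Longrightarrow> G (w(c := v)) t = G w t"
  shows "(\<integral>\<^sup>+w. G w (S w + w c) \<partial>P) =
    (\<integral>\<^sup>+w. (\<integral>\<^sup>+t. indicator {S w<..S w + w c} t * (ennreal (r c) * G w t) \<partial>lborel) \<partial>P)"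
proof -
  have G'[measurable (raw)]: "(\<lambda>x. G (a x) (b x)) \<in> borel_measurable M"
    if "a \<in> measurable M P" "b \<in> borel_measurable M" for a b M
    using measurable_compose[OF measurable_Pair[OF that] G] by simp
  have "(\<integral>\<^sup>+w. G w (S w + w c) \<partial>P) =
    (\<integral>\<^sup>+w. (\<integral>\<^sup>+u. indicator {0<..w c} u * (ennreal (r c) * G w (S w + u)) \<partial>lborel) \<partial>P)"
    by (rule compensator_age[where f="\<lambda>w u. G w (S w + u)"])
       (auto simp: case_prod_unfold S_indep nonant)
  also have "\<dots> = (\<integral>\<^sup>+w. (\<integral>\<^sup>+t. indicator {S w<..S w + w c} t * (ennreal (r c) * G w t) \<partial>lborel) \<partial>P)"
  proof (rule nn_integral_cong)
    fix w
    have [measurable]: "(\<lambda>t. indicator {S w<..S w + w c} t * (ennreal (r c) * G w t)) \<in> borel_measurable borel"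
      by measurable
    have "(\<integral>\<^sup>+t. indicator {S w<..S w + w c} t * (ennreal (r c) * G w t) \<partial>lborel)
      = (\<integral>\<^sup>+u. indicator {S w<..S w + w c} (S w + u) * (ennreal (r c) * G w (S w + u)) \<partial>lborel)"
      by (subst nn_integral_real_affine[where c=1 and t="S w"]) auto
    also have "\<dots> = (\<integral>\<^sup>+u. indicator {0<..w c} u * (ennreal (r c) * G w (S w + u)) \<partial>lborel)"
      by (intro nn_integral_cong) (auto simp: indicator_def)
    finally show "(\<integral>\<^sup>+u. indicator {0<..w c} u * (ennreal (r c) * G w (S w + u)) \<partial>lborel)
      = (\<integral>\<^sup>+t. indicator {S w<..S w + w c} t * (ennreal (r c) * G w t) \<partial>lborel)" ..
  qed
  finally show ?thesis .
qed

text \<open>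
  For signed bounded rewards the right-hand side is an integral over the product space, so that
  the contributions of several clocks can be added under one integral sign before the order of
  integration is exchanged.
\<close>

lemma compensator:
  fixes J :: "('c \<Rightarrow> real) \<Rightarrow> real \<Rightarrow> real"
  assumes S[measurable]: "S \<in> borel_measurable P"
    and S_indep: "\<And>w v. S (w(c := v)) = S w"
    and J: "(\<lambda>(w, t). J w t) \<in> borel_measurable (P \<Otimes>\<^sub>M borel)"
    and bound: "\<And>w t. \<bar>J w t\<bar> \<le> B"
    and nonant: "\<And>w t v. (\<forall>c. 0 < w c) \<Longrightarrow> S w < t \<Longrightarrow> t \<le> S w + w c \<Longrightarrow> t \<le> S w + v
      \<Longrightarrow> J (w(c := v)) t = J w t"
  shows "integrable P (\<lambda>w. indicator {a<..b} (S w + w c) * J w (S w + w c))" (is "integrable P ?L")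
    and "integrable (P \<Otimes>\<^sub>M lborel) (\<lambda>(w, t). indicator {a<..b} t * (r c * (indicator {S w<..S w + w c} t * J w t)))"
      (is "integrable _ ?R")
    and "(\<integral>w. indicator {a<..b} (S w + w c) * J w (S w + w c) \<partial>P) =
      (\<integral>(w, t). indicator {a<..b} t * (r c * (indicator {S w<..S w + w c} t * J w t)) \<partial>(P \<Otimes>\<^sub>M lborel))"
proof -
  have J'[measurable (raw)]: "(\<lambda>x. J (x1 x) (b x)) \<in> borel_measurable M"
    if "x1 \<in> measurable M P" "b \<in> borel_measurable M" for x1 b M
    using measurable_compose[OF measurable_Pair[OF that] J] by simp
  have B: "0 \<le> B" using bound[of undefined undefined] by linarith
  interpret pair_sigma_finite P lborel ..
  have U: "UNIV \<in> sets P" using sets.top[of P] by simp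
  have ind: "(indicator {x<..y} z :: real) = (if x < z \<and> z \<le> y then 1 else 0)" for x y z :: real
    by (auto simp: indicator_def)
  show L: "integrable P ?L"
    by (rule clk.integrable_const_bound[where B=B])
       (use bound B in \<open>auto simp: ind abs_mult\<close>)
  have R_meas: "?R \<in> borel_measurable (P \<Otimes>\<^sub>M lborel)"
    unfolding case_prod_unfold ind by measurable
  show R: "integrable (P \<Otimes>\<^sub>M lborel) ?R"
  proof (rule Bochner_Integration.integrable_bound[OF _ R_meas])
    have "emeasure (P \<Otimes>\<^sub>M lborel) (UNIV \<times> {a<..b}) < \<infinity>"
      using U clk.emeasure_space_1
      by (cases "a \<le> b") (simp_all add: lborel.emeasure_pair_measure_Times)
    then show "integrable (P \<Otimes>\<^sub>M lborel) (\<lambda>x. r c * B * indicator (UNIV \<times> {a<..b}) x)"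
      using pair_measureI[of UNIV P "{a<..b}" lborel] U
      by (intro integrable_mult_right integrable_real_indicator) auto
    show "AE x in P \<Otimes>\<^sub>M lborel. norm (?R x) \<le> norm (r c * B * indicator (UNIV \<times> {a<..b}) x)"
      using r_pos[of c] bound B
      by (intro AE_I2) (auto simp: indicator_def abs_mult mult_left_mono)
  qed
  have key: "(\<integral>\<^sup>+w. ennreal (s * ?L w) \<partial>P) = (\<integral>\<^sup>+x. ennreal (s * ?R x) \<partial>(P \<Otimes>\<^sub>M lborel))" for s
  proof -
    let ?G = "\<lambda>w t. ennreal (s * (indicator {a<..b} t * J w t))"
    have "(\<integral>\<^sup>+w. ?G w (S w + w c) \<partial>P) =
      (\<integral>\<^sup>+w. (\<integral>\<^sup>+t. indicator {S w<..S w + w c} t * (ennreal (r c) * ?G w t) \<partial>lborel) \<partial>P)"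
      by (rule compensator_nn) (auto simp: S_indep nonant ind case_prod_unfold)
    also have "\<dots> = (\<integral>\<^sup>+w. (\<integral>\<^sup>+t. ennreal (s * ?R (w, t)) \<partial>lborel) \<partial>P)"
      using r_pos[of c]
      by (intro nn_integral_cong) (auto simp: indicator_def ennreal_mult'[symmetric] ac_simps)
    also have "\<dots> = (\<integral>\<^sup>+x. ennreal (s * ?R x) \<partial>(P \<Otimes>\<^sub>M lborel))"
      by (intro lborel.nn_integral_fst borel_measurable_times measurable_compose[OF _ measurable_ennreal]
           measurable_const R_meas) simp
    finally show ?thesis .
  qed
  show "(\<integral>w. ?L w \<partial>P) = (\<integral>x. ?R x \<partial>(P \<Otimes>\<^sub>M lborel))"
    unfolding real_lebesgue_integral_def[OF L] real_lebesgue_integral_def[OF R]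
    using key[of 1] key[of "-1"] by simp
qed

end

section \<open>Sample paths of the truncated system\<close>

instance sys :: finite
proof
  have "x \<in> {Original, Fictitious}" for x
    by (cases x) simp_all
  then have "UNIV \<subseteq> {Original, Fictitious}" by blast
  then show "finite (UNIV :: sys set)" by (rule finite_subset) simp
qed

instance clock :: (countable) countable
  by countable_datatype

type_synonym 'm counts = "sys \<Rightarrow> 'm \<Rightarrow> nat"

definition incr :: "'m counts \<Rightarrow> sys \<Rightarrow> 'm \<Rightarrow> 'm counts" where
  "incr z q i = z(q := (z q)(i := z q i + 1))"

definition decr :: "'m counts \<Rightarrow> sys \<Rightarrow> 'm \<Rightarrow> 'm counts" where
  "decr z q i = z(q := (z q)(i := z q i - 1))"

text \<open>
  Each clock \<open>c\<close> runs on the interval from \<open>start w c\<close> to \<open>ring w c\<close>. The service clocks of both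
  systems run from the arrival on, and only the one in the chosen system has an effect when it
  rings. In this way the running intervals do not involve the routing decisions.
\<close>

fun start :: "('m clock \<Rightarrow> real) \<Rightarrow> 'm clock \<Rightarrow> real" where
  "start w (Interarrival i n) = (\<Sum>l<n. w (Interarrival i l))"
| "start w (Service q i n) = (\<Sum>l\<le>n. w (Interarrival i l))"
| "start w (Residual q i k) = 0"

definition ring :: "('m clock \<Rightarrow> real) \<Rightarrow> 'm clock \<Rightarrow> real" where
  "ring w c = start w c + w c"

lemma ring_simps:
  "ring w (Interarrival i n) = (\<Sum>l\<le>n. w (Interarrival i l))"
  "ring w (Service q i n) = ring w (Interarrival i n) + w (Service q i n)"
  "ring w (Residual q i k) = w (Residual q i k)"
  by (simp_all add: ring_def lessThan_Suc_atMost[symmetric])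

lemma start_Service: "start w (Service q i n) = ring w (Interarrival i n)"
  by (simp add: ring_simps)

lemma start_Interarrival_Suc: "start w (Interarrival i (Suc n)) = ring w (Interarrival i n)"
  by (simp add: ring_simps lessThan_Suc_atMost)

lemma start_upd: "start (w(c := v)) c = start w c"
  by (cases c) auto

lemma start_nonneg:
  assumes "\<And>c. 0 < w c"
  shows "0 \<le> start w c"
  by (cases c) (simp_all add: sum_nonneg less_imp_le[OF assms])

lemma ring_Interarrival_mono:
  assumes "\<And>c. 0 < w c" "n \<le> n'"
  shows "ring w (Interarrival i n) \<le> ring w (Interarrival i n')"
  unfolding ring_simps using assms(2) by (intro sum_mono2) (simp_all add: less_imp_le[OF assms(1)])

text \<open>
  Changing the value of a clock that is still running at time \<open>t\<close> moves no ring before \<open>t\<close>. This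
  is where positivity of the clocks matters: whatever starts only when \<open>c\<close> has rung does not ring
  before \<open>t\<close> either.
\<close>

lemma ring_upd_beyond:
  assumes w: "\<And>c. 0 < w c" and t: "start w c < t" "t \<le> start w c + w c" "t \<le> start w c + v"
  shows "min t (ring (w(c := v)) c') = min t (ring w c')"
proof -
  let ?w = "w(c := v)"
  have v: "0 < v" using t by linarith
  have w': "0 < ?w c'" for c' using w v by simp
  have self: "t \<le> ring ?w c" "t \<le> ring w c"
    using t by (auto simp: ring_def start_upd)
  show ?thesis
  proof (cases c)
    case (Interarrival i n)
    have arr: "min t (ring ?w (Interarrival j m)) = min t (ring w (Interarrival j m))" for j m
    proof (cases "j = i \<and> n \<le> m")
      case True
      then have "t \<le> ring ?w (Interarrival j m)" "t \<le> ring w (Interarrival j m)"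
        using self ring_Interarrival_mono[of w n m i, OF w] ring_Interarrival_mono[of ?w n m i, OF w']
        by (auto simp: Interarrival)
      then show ?thesis by simp
    next
      case False
      then have "ring ?w (Interarrival j m) = ring w (Interarrival j m)"
        unfolding ring_simps Interarrival by (intro sum.cong) auto
      then show ?thesis by simp
    qed
    show ?thesis
    proof (cases c')
      case c': (Service q j m)
      have "0 < w (Service q j m)" by (rule w)
      then show ?thesis
        using arr[of j m] by (simp add: c' Interarrival ring_simps(2) min_def split: if_splits)
    qed (use arr in \<open>auto simp: ring_simps(3) Interarrival\<close>)
  next
    case (Service q i n)
    then have "ring ?w c' = ring w c'" if "c' \<noteq> c"
      using that by (cases c') (auto simp: ring_simps)
    then show ?thesis using self by (cases "c' = c") auto
  next
    case (Residual q i n)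
    then have "ring ?w c' = ring w c'" if "c' \<noteq> c"
      using that by (cases c') (auto simp: ring_simps)
    then show ?thesis using self by (cases "c' = c") auto
  qed
qed

lemma card_eq_Suc_card: "A = insert n B \<Longrightarrow> n \<notin> B \<Longrightarrow> finite B \<Longrightarrow> card A = Suc (card B)"
  by simp

text \<open>
  Only the first \<open>K\<close> arrivals of each class take place, and \<open>\<nu>\<close> is a fixed initial population.
  Then finitely many clocks matter and the population stays bounded, so that every expectation is
  finite. The drift estimate survives the truncation because omitting an arrival can only lower
  a function that increases with the population.
\<close>

locale truncated_system =
  fixes pol :: "('m::finite) counts \<Rightarrow> 'm \<Rightarrow> sys"
    and \<nu> :: "'m counts" and K :: nat
begin

definition clocks :: "'m clock set" where
  "clocks = (\<lambda>(i, n). Interarrival i n) ` (UNIV \<times> {..<K})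
     \<union> (\<lambda>(q, i, n). Service q i n) ` (UNIV \<times> UNIV \<times> {..<K})
     \<union> (\<lambda>(q, i, k). Residual q i k) ` (SIGMA q : UNIV. SIGMA i : UNIV. {..<\<nu> q i})"

lemma clocks_iff[simp]:
  "Interarrival i n \<in> clocks \<longleftrightarrow> n < K"
  "Service q i n \<in> clocks \<longleftrightarrow> n < K"
  "Residual q i k \<in> clocks \<longleftrightarrow> k < \<nu> q i"
  by (auto simp: clocks_def image_iff)

lemma finite_clocks: "finite clocks"
  by (simp add: clocks_def)

text \<open>
  The population is described through the set \<open>F\<close> of clocks that have rung. The state at time \<open>t\<close>
  and its left limit are the same function of \<open>F\<close>, with \<open>ring w c \<le> t\<close> or \<open>ring w c < t\<close>.
\<close>

definition population :: "('m \<Rightarrow> nat \<Rightarrow> sys) \<Rightarrow> 'm clock set \<Rightarrow> 'm counts" where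
  "population R F q i =
     card {k. k < \<nu> q i \<and> Residual q i k \<notin> F} +
     card {n. n < K \<and> R i n = q \<and> Interarrival i n \<in> F \<and> Service q i n \<notin> F}"

text \<open>
  The policy determines each decision from the decisions for earlier arrivals. Rather than sorting
  the arrivals, all decisions are recomputed \<open>d\<close> times from an arbitrary first guess: an arrival
  with fewer than \<open>d\<close> predecessors is then routed correctly. Measurability and dependence on the
  past only both become inductions on \<open>d\<close>.
\<close>

fun route :: "nat \<Rightarrow> ('m clock \<Rightarrow> real) \<Rightarrow> 'm \<Rightarrow> nat \<Rightarrow> sys" where
  "route 0 w i n = Original"
| "route (Suc d) w i n = pol (population (route d w) {c. ring w c < ring w (Interarrival i n)}) i"

definition routing :: "('m clock \<Rightarrow> real) \<Rightarrow> 'm \<Rightarrow> nat \<Rightarrow> sys" where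
  "routing = route (Suc (CARD('m) * K))"

definition before :: "('m clock \<Rightarrow> real) \<Rightarrow> real \<Rightarrow> 'm counts" where
  "before w t = population (routing w) {c. ring w c < t}"

definition after :: "('m clock \<Rightarrow> real) \<Rightarrow> real \<Rightarrow> 'm counts" where
  "after w t = population (routing w) {c. ring w c \<le> t}"

text \<open>
  The effect of the ring of \<open>c\<close> on the population. A service clock in the system that was not
  chosen has none.
\<close>

definition fire :: "('m clock \<Rightarrow> real) \<Rightarrow> 'm clock \<Rightarrow> 'm counts \<Rightarrow> 'm counts" where
  "fire w c z = (case c of
       Interarrival i n \<Rightarrow> incr z (pol z i) i
     | Service q i n \<Rightarrow> if routing w i n = q then decr z q i else z
     | Residual q i k \<Rightarrow> decr z q i)"

lemma population_cong:
  assumes "\<And>c. c \<in> clocks \<Longrightarrow> c \<in> F \<longleftrightarrow> c \<in> F'"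
    and "\<And>i n. n < K \<Longrightarrow> Interarrival i n \<in> F \<Longrightarrow> R i n = R' i n"
  shows "population R F = population R' F'"
proof (intro ext)
  fix q i
  have "{k. k < \<nu> q i \<and> Residual q i k \<notin> F} = {k. k < \<nu> q i \<and> Residual q i k \<notin> F'}"
    using assms(1)[of "Residual q i _"] by auto
  moreover have "{n. n < K \<and> R i n = q \<and> Interarrival i n \<in> F \<and> Service q i n \<notin> F}
      = {n. n < K \<and> R' i n = q \<and> Interarrival i n \<in> F' \<and> Service q i n \<notin> F'}"
    using assms(1)[of "Service q i _"] assms(1)[of "Interarrival i _"] assms(2)[of _ i] by auto
  ultimately show "population R F q i = population R' F' q i"
    by (simp add: population_def)
qed

definition rank :: "('m clock \<Rightarrow> real) \<Rightarrow> 'm \<Rightarrow> nat \<Rightarrow> nat" where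
  "rank w i n = card {(j, m). m < K \<and> ring w (Interarrival j m) < ring w (Interarrival i n)}"

lemma finite_rank_set: "finite {(j :: 'm, m). m < K \<and> P j m}"
  by (rule finite_subset[of _ "UNIV \<times> {..<K}"]) auto

lemma rank_less:
  assumes "n < K" "ring w (Interarrival i n) < ring w (Interarrival j m)"
  shows "rank w i n < rank w j m"
  unfolding rank_def using assms by (intro psubset_card_mono finite_rank_set) auto

lemma rank_le: "rank w i n \<le> CARD('m) * K"
proof -
  have "rank w i n \<le> card ((UNIV :: 'm set) \<times> {..<K})"
    unfolding rank_def by (rule card_mono) auto
  then show ?thesis by (simp add: card_cartesian_product)
qed

text \<open>
  The number of predecessors strictly decreases from an arrival to any earlier one, so the
  decisions for the predecessors of an arrival of rank below \<open>d + 1\<close> are final after \<open>d\<close> rounds.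
\<close>

lemma route_stable: "rank w i n < d \<Longrightarrow> route d w i n = route (Suc d) w i n"
proof (induction d arbitrary: i n)
  case (Suc d)
  have "population (route d w) {c. ring w c < ring w (Interarrival i n)} =
        population (route (Suc d) w) {c. ring w c < ring w (Interarrival i n)}"
    using Suc rank_less[of _ w _ i n] by (intro population_cong) fastforce+
  then show ?case by simp
qed simp

lemma routing_eq: "routing w i n = pol (before w (ring w (Interarrival i n))) i"
  using route_stable[of w i n "Suc (CARD('m) * K)"] rank_le[of w i n]
  by (simp add: routing_def before_def)

lemma route_unique:
  assumes R: "\<And>i n. n < K \<Longrightarrow> ring w (Interarrival i n) \<le> T \<Longrightarrow>
      R i n = pol (population R {c. ring w c < ring w (Interarrival i n)}) i"
    and "n < K" "ring w (Interarrival i n) \<le> T" "rank w i n < d"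
  shows "route d w i n = R i n"
  using assms(2-)
proof (induction d arbitrary: i n)
  case (Suc d)
  have "population (route d w) {c. ring w c < ring w (Interarrival i n)} =
        population R {c. ring w c < ring w (Interarrival i n)}"
  proof (rule population_cong)
    fix j m assume "m < K" "Interarrival j m \<in> {c. ring w c < ring w (Interarrival i n)}"
    then show "route d w j m = R j m"
      using Suc.prems rank_less[of m w j i n] by (intro Suc.IH) auto
  qed simp
  then show ?case using R[OF Suc.prems(1,2)] by simp
qed simp

lemma routing_unique:
  assumes "\<And>i n. n < K \<Longrightarrow> ring w (Interarrival i n) \<le> T \<Longrightarrow>
      R i n = pol (population R {c. ring w c < ring w (Interarrival i n)}) i"
    and "n < K" "ring w (Interarrival i n) \<le> T"
  shows "routing w i n = R i n"
  unfolding routing_def using assms rank_le[of w i n] by (intro route_unique) auto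

lemma min_eq_less_iff: "min (t::real) a = min t b \<Longrightarrow> s \<le> t \<Longrightarrow> a < s \<longleftrightarrow> b < s"
  by (auto simp: min_def split: if_splits)

lemma route_nonanticipating:
  assumes "\<And>c. min t (ring w' c) = min t (ring w c)" and "ring w (Interarrival i n) < t"
  shows "route d w' i n = route d w i n"
  using assms(2)
proof (induction d arbitrary: i n)
  case (Suc d)
  have eq: "ring w' (Interarrival i n) = ring w (Interarrival i n)"
    using assms(1)[of "Interarrival i n"] Suc.prems by (auto simp: min_def split: if_splits)
  have iff: "ring w' c < ring w' (Interarrival i n) \<longleftrightarrow> ring w c < ring w (Interarrival i n)" for c
    using min_eq_less_iff[OF assms(1)[of c], of "ring w (Interarrival i n)"] Suc.prems eq by simp
  have "population (route d w') {c. ring w' c < ring w' (Interarrival i n)} =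
        population (route d w) {c. ring w c < ring w (Interarrival i n)}"
    using Suc by (intro population_cong) (auto simp: iff)
  then show ?case by simp
qed simp

text \<open>
  Two realizations of the clocks with the same rings before \<open>t\<close> lead to the same state just
  before \<open>t\<close>, decisions included.
\<close>

lemma before_nonanticipating:
  assumes "\<And>c. min t (ring w' c) = min t (ring w c)"
  shows "before w' t = before w t"
  unfolding before_def routing_def
  using min_eq_less_iff[OF assms order_refl]
  by (intro population_cong) (auto intro!: route_nonanticipating[OF assms] simp del: route.simps)

lemma population_insert_Interarrival:
  assumes "n < K" "Interarrival i n \<notin> F" "Service (R i n) i n \<notin> F"
  shows "population R (insert (Interarrival i n) F) = incr (population R F) (R i n) i"
proof (intro ext)
  fix q j
  let ?A = "\<lambda>F. {m. m < K \<and> R j m = q \<and> Interarrival j m \<in> F \<and> Service q j m \<notin> F}"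
  show "population R (insert (Interarrival i n) F) q j = incr (population R F) (R i n) i q j"
  proof (cases "j = i \<and> q = R i n")
    case True
    then have "?A (insert (Interarrival i n) F) = insert n (?A F)" "n \<notin> ?A F"
      using assms by auto
    then have "card (?A (insert (Interarrival i n) F)) = Suc (card (?A F))" by simp
    with True show ?thesis by (simp add: population_def incr_def)
  next
    case False
    then have "?A (insert (Interarrival i n) F) = ?A F" by auto
    with False show ?thesis by (auto simp: population_def incr_def)
  qed
qed

lemma population_insert_Service:
  assumes "n < K" "Interarrival i n \<in> F" "Service q i n \<notin> F"
  shows "population R (insert (Service q i n) F) =
    (if R i n = q then decr (population R F) q i else population R F)"
proof (intro ext)
  fix p j
  let ?A = "\<lambda>F. {m. m < K \<and> R j m = p \<and> Interarrival j m \<in> F \<and> Service p j m \<notin> F}"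
  show "population R (insert (Service q i n) F) p j =
    (if R i n = q then decr (population R F) q i else population R F) p j"
  proof (cases "j = i \<and> p = q \<and> R i n = q")
    case True
    then have "?A F = insert n (?A (insert (Service q i n) F))" "n \<notin> ?A (insert (Service q i n) F)"
      using assms by auto
    then have "card (?A F) = Suc (card (?A (insert (Service q i n) F)))" by (rule card_eq_Suc_card) simp
    with True show ?thesis by (simp add: population_def decr_def)
  next
    case False
    then have "?A (insert (Service q i n) F) = ?A F" by auto
    with False show ?thesis by (auto simp: population_def decr_def)
  qed
qed

lemma population_insert_Residual:
  assumes "k < \<nu> q i" "Residual q i k \<notin> F"
  shows "population R (insert (Residual q i k) F) = decr (population R F) q i"
proof (intro ext)
  fix p j
  let ?A = "\<lambda>F. {m. m < \<nu> p j \<and> Residual p j m \<notin> F}"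
  show "population R (insert (Residual q i k) F) p j = decr (population R F) q i p j"
  proof (cases "j = i \<and> p = q")
    case True
    then have "?A F = insert k (?A (insert (Residual q i k) F))" "k \<notin> ?A (insert (Residual q i k) F)"
      using assms by auto
    then have "card (?A F) = Suc (card (?A (insert (Residual q i k) F)))" by (rule card_eq_Suc_card) simp
    with True show ?thesis by (simp add: population_def decr_def)
  next
    case False
    then have "?A (insert (Residual q i k) F) = ?A F" by auto
    with False show ?thesis by (auto simp: population_def decr_def)
  qed
qed

lemma after_ring:
  assumes w: "\<And>c. 0 < w c" and c: "c \<in> clocks"
    and inj: "\<And>c'. c' \<in> clocks \<Longrightarrow> ring w c' = ring w c \<Longrightarrow> c' = c"
  shows "after w (ring w c) = fire w c (before w (ring w c))"
proof -
  let ?F = "{c'. ring w c' < ring w c}"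
  have "after w (ring w c) = population (routing w) (insert c ?F)"
    unfolding after_def by (rule population_cong) (use inj in fastforce)+
  also have "\<dots> = fire w c (before w (ring w c))"
  proof (cases c)
    case (Interarrival i n)
    have "0 < w (Service (routing w i n) i n)" by (rule w)
    then show ?thesis using c
      by (subst Interarrival, subst population_insert_Interarrival)
         (auto simp: Interarrival fire_def ring_simps(2) before_def[symmetric] routing_eq[of w i n])
  next
    case (Service q i n)
    have "0 < w (Service q i n)" by (rule w)
    then show ?thesis using c
      by (subst Service, subst population_insert_Service)
         (auto simp: Service fire_def ring_simps(2) before_def[symmetric])
  next
    case (Residual q i k)
    then show ?thesis using c
      by (subst Residual, subst population_insert_Residual)
         (auto simp: fire_def before_def[symmetric])
  qed
  finally show ?thesis .
qed

lemma after_eq_before: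
  assumes "s < t" "\<And>c. c \<in> clocks \<Longrightarrow> ring w c \<le> s \<or> t \<le> ring w c"
  shows "before w t = after w s"
  unfolding before_def after_def using assms by (intro population_cong) fastforce+

lemma after_eq_before_same:
  assumes "t \<notin> ring w ` clocks"
  shows "after w t = before w t"
  unfolding before_def after_def using assms by (intro population_cong) (auto simp: order_less_le)

text \<open>
  Between two consecutive rings nothing happens, and at each ring time exactly one clock rings, so
  the change of a function along the path is the sum of its jumps. The induction removes the last
  ring before \<open>t\<close>; it needs the left limit on the left-hand side, so that this ring can be
  the next end point.
\<close>

lemma before_telescope:
  fixes \<Phi> :: "'m counts \<Rightarrow> real"
  assumes w: "\<And>c. 0 < w c" and inj: "inj_on (ring w) clocks" and "s < t"
  shows "\<Phi> (before w t) = \<Phi> (after w s) +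
    (\<Sum>c | c \<in> clocks \<and> s < ring w c \<and> ring w c < t. 
        \<Phi> (fire w c (before w (ring w c))) - \<Phi> (before w (ring w c)))"
  using \<open>s < t\<close>
proof (induction "card {c \<in> clocks. s < ring w c \<and> ring w c < t}" arbitrary: t rule: less_induct)
  case less
  let ?C = "\<lambda>t. {c \<in> clocks. s < ring w c \<and> ring w c < t}"
  have fin: "finite (?C t)" for t using finite_clocks by simp
  show ?case
  proof (cases "?C t = {}")
    case True
    then have "before w t = after w s"
      using less.prems by (intro after_eq_before) force+
    then show ?thesis unfolding True by simp
  next
    case False
    \<comment> \<open>The last ring before \<open>t\<close>.\<close>
    define u where "u = Max (ring w ` ?C t)"
    have "u \<in> ring w ` ?C t" unfolding u_def using fin False by (intro Max_in) auto
    then obtain c where c: "c \<in> ?C t" "u = ring w c" by auto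
    have max: "ring w c' \<le> u" if "c' \<in> ?C t" for c'
      unfolding u_def using fin that by (intro Max_ge) auto
    have split: "?C t = insert c (?C u)" "c \<notin> ?C u"
    proof -
      show "c \<notin> ?C u" using c by simp
      have top: "c' = c" if "c' \<in> ?C t" "c' \<notin> ?C u" for c'
        using max[OF that(1)] that c by (intro inj_onD[OF inj]) auto
      show "?C t = insert c (?C u)"
      proof (intro equalityI subsetI)
        fix c' assume "c' \<in> ?C t"
        then show "c' \<in> insert c (?C u)" using top[of c'] by blast
      next
        fix c' assume "c' \<in> insert c (?C u)"
        then show "c' \<in> ?C t" using c by (elim insertE) simp_all
      qed
    qed
    have "card (?C u) < card (?C t)"
      by (subst split(1)) (simp only: card_insert_disjoint[OF fin split(2)] lessI)
    then have IH: "\<Phi> (before w u) = \<Phi> (after w s) +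
      (\<Sum>c \<in> ?C u. \<Phi> (fire w c (before w (ring w c))) - \<Phi> (before w (ring w c)))"
      using c by (intro less.hyps) simp_all
    have "before w t = after w u"
    proof (rule after_eq_before)
      show "u < t" using c by simp
      show "ring w c' \<le> u \<or> t \<le> ring w c'" if "c' \<in> clocks" for c'
        using max[of c'] that c by (cases "s < ring w c' \<and> ring w c' < t") auto
    qed
    also have "\<dots> = fire w c (before w u)"
      unfolding c(2) using w c inj by (intro after_ring) (auto simp: inj_on_def)
    finally have "\<Phi> (before w t) = \<Phi> (before w u) + (\<Phi> (fire w c (before w u)) - \<Phi> (before w u))"
      by simp
    then show ?thesis
      by (subst split(1), subst sum.insert[OF fin split(2)]) (simp add: IH c(2)[symmetric])
  qed
qed

lemma after_telescope:
  fixes \<Phi> :: "'m counts \<Rightarrow> real"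
  assumes w: "\<And>c. 0 < w c" and inj: "inj_on (ring w) clocks" and "s \<le> t"
  shows "\<Phi> (after w t) - \<Phi> (after w s) =
    (\<Sum>c\<in>clocks. indicator {s<..t} (ring w c) * 
        (\<Phi> (fire w c (before w (ring w c))) - \<Phi> (before w (ring w c))))"
proof -
  let ?D = "\<lambda>c. \<Phi> (fire w c (before w (ring w c))) - \<Phi> (before w (ring w c))"
  \<comment> \<open>After \<open>t\<close> there is an interval without rings, so the state at \<open>t\<close> is the left limit at \<open>T\<close>.\<close>
  obtain T where T: "t < T" "\<And>c. c \<in> clocks \<Longrightarrow> ring w c \<le> t \<or> T \<le> ring w c"
  proof -
    let ?A = "ring w ` {c \<in> clocks. t < ring w c}"
    have fin: "finite ?A" using finite_clocks by simp
    show ?thesis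
    proof (cases "?A = {}")
      case True
      then show ?thesis by (intro that[of "t + 1"]) (auto simp: not_less)
    next
      case False
      have "t < Min ?A" using fin False by (subst Min_gr_iff) auto
      moreover have "ring w c \<le> t \<or> Min ?A \<le> ring w c" if "c \<in> clocks" for c
        using fin that by (cases "ring w c \<le> t") (auto intro!: Min_le)
      ultimately show ?thesis by (rule that)
    qed
  qed
  have "\<Phi> (after w t) = \<Phi> (before w T)"
    using after_eq_before[OF T] by simp
  also have "\<dots> = \<Phi> (after w s) + (\<Sum>c | c \<in> clocks \<and> s < ring w c \<and> ring w c < T. ?D c)"
    using w inj \<open>s \<le> t\<close> T(1) by (intro before_telescope) auto
  also have "{c \<in> clocks. s < ring w c \<and> ring w c < T} = {c \<in> clocks. ring w c \<in> {s<..t}}"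
    using T by fastforce
  also have "(\<Sum>c \<in> {c \<in> clocks. ring w c \<in> {s<..t}}. ?D c) = (\<Sum>c\<in>clocks. indicator {s<..t} (ring w c) * ?D c)"
    by (subst sum.inter_filter[OF finite_clocks], rule sum.cong) (simp_all add: indicator_def)
  finally show ?thesis by simp
qed

lemma sum_clocks:
  fixes f :: "'m clock \<Rightarrow> real"
  shows "(\<Sum>c\<in>clocks. f c) = (\<Sum>i\<in>UNIV. \<Sum>n<K. f (Interarrival i n)) +
    (\<Sum>q\<in>UNIV. \<Sum>i\<in>UNIV. (\<Sum>n<K. f (Service q i n)) + (\<Sum>k<\<nu> q i. f (Residual q i k)))"
proof -
  let ?A = "(\<lambda>(i :: 'm, n). Interarrival i n) ` (UNIV \<times> {..<K})"
  let ?B = "(\<lambda>(q, i :: 'm, n). Service q i n) ` (UNIV \<times> UNIV \<times> {..<K})"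
  let ?C = "(\<lambda>(q, i :: 'm, k). Residual q i k) ` (SIGMA q : UNIV. SIGMA i : UNIV. {..<\<nu> q i})"
  have "(\<Sum>c\<in>clocks. f c) = sum f ?A + sum f ?B + sum f ?C"
    unfolding clocks_def by (subst sum.union_disjoint; (subst sum.union_disjoint)?; auto)
  also have "sum f ?A = (\<Sum>i\<in>UNIV. \<Sum>n<K. f (Interarrival i n))"
    by (subst sum.reindex) (auto simp: inj_on_def sum.cartesian_product case_prod_unfold)
  also have "sum f ?B = (\<Sum>q\<in>UNIV. \<Sum>i\<in>UNIV. \<Sum>n<K. f (Service q i n))"
    by (subst sum.reindex) (auto simp: inj_on_def sum.cartesian_product case_prod_unfold)
  also have "sum f ?C = (\<Sum>q\<in>UNIV. \<Sum>i\<in>UNIV. \<Sum>k<\<nu> q i. f (Residual q i k))"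
    by (subst sum.reindex) (auto simp: inj_on_def sum.Sigma case_prod_unfold)
  finally show ?thesis by (simp add: sum.distrib)
qed

end

section \<open>Expectations in the truncated system\<close>

text \<open>
  A comparison with the solution \<open>e\<close> of the equation \<open>e' = c * (B - e)\<close>, which starts at \<open>u 0\<close>. The
  inequality is assumed on all subintervals, since on intervals starting at 0 alone it would allow
  \<open>u\<close> to save up slack while it is below \<open>B\<close>.
\<close>

lemma gronwall_affine:
  fixes u :: "real \<Rightarrow> real"
  assumes T: "0 \<le> T" and cont: "continuous_on {0..T} u"
    and incr: "\<And>s t. 0 \<le> s \<Longrightarrow> s < t \<Longrightarrow> t \<le> T \<Longrightarrow>
      u t - u s \<le> (\<integral>\<tau>. indicator {s<..t} \<tau> * (c * (B - u \<tau>)) \<partial>lborel)"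
    and c: "0 < c"
  shows "u T \<le> B + (u 0 - B) * exp (- c * T)"
proof (rule ccontr)
  define e where "e t = B + (u 0 - B) * exp (- c * t)" for t
  assume "\<not> ?thesis"
  then have above: "e T < u T" by (simp add: e_def)
  have e0: "e 0 = u 0" by (simp add: e_def)
  \<comment> \<open>After the last time \<open>s\<close> at which \<open>u\<close> is not above \<open>e\<close>, it would have to grow faster than \<open>e\<close>.\<close>
  define A where "A = {t \<in> {0..T}. u t \<le> e t}"
  have cont_e: "continuous_on X e" for X
    unfolding e_def by (intro continuous_intros)
  have "closed A"
    unfolding A_def using cont cont_e by (intro continuous_on_closed_Collect_le) auto
  moreover have "bounded A" by (rule bounded_subset[of "{0..T}"]) (auto simp: A_def)
  ultimately have "compact A" by (simp add: compact_eq_bounded_closed)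
  moreover have "0 \<in> A" using T e0 by (simp add: A_def)
  ultimately obtain s where s: "s \<in> A" "\<And>t. t \<in> A \<Longrightarrow> t \<le> s"
    using compact_attains_sup[of A] by auto
  have s': "0 \<le> s" "s < T" "u s \<le> e s"
    using s(1) above by (auto simp: A_def order_less_le)
  have later: "e t < u t" if "s < t" "t \<le> T" for t
    using s(2)[of t] that s' by (force simp: A_def)
  have deriv: "(e has_real_derivative c * (B - e t)) (at t within X)" for t X
    unfolding e_def by (auto intro!: derivative_eq_intros simp: algebra_simps)
  have FTC: "has_bochner_integral lborel (\<lambda>t. indicator {s..T} t *\<^sub>R (c * (B - e t))) (e T - e s)"
    using s' deriv cont_e
    by (intro has_bochner_integral_FTC_Icc)
       (auto simp: has_real_derivative_iff_has_vector_derivative[symmetric] intro!: continuous_intros)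
  have "u T - u s \<le> (\<integral>\<tau>. indicator {s<..T} \<tau> * (c * (B - u \<tau>)) \<partial>lborel)"
    using s' by (intro incr) auto
  also have "\<dots> \<le> (\<integral>\<tau>. indicator {s..T} \<tau> *\<^sub>R (c * (B - e \<tau>)) \<partial>lborel)"
  proof (rule integral_mono_AE)
    have "set_integrable lborel {s..T} (\<lambda>\<tau>. c * (B - u \<tau>))"
      using s' by (intro borel_integrable_atLeastAtMost') (auto intro!: continuous_intros continuous_on_subset[OF cont])
    then have "set_integrable lborel {s<..T} (\<lambda>\<tau>. c * (B - u \<tau>))"
      by (rule set_integrable_subset) auto
    then show "integrable lborel (\<lambda>\<tau>. indicator {s<..T} \<tau> * (c * (B - u \<tau>)))"
      by (simp add: set_integrable_def)
    show "integrable lborel (\<lambda>\<tau>. indicator {s..T} \<tau> *\<^sub>R (c * (B - e \<tau>)))"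
      using FTC by (simp add: has_bochner_integral_iff)
    have "AE \<tau> in lborel. \<tau> \<noteq> s" by (rule AE_lborel_singleton)
    then show "AE \<tau> in lborel. indicator {s<..T} \<tau> * (c * (B - u \<tau>)) \<le> indicator {s..T} \<tau> *\<^sub>R (c * (B - e \<tau>))"
    proof eventually_elim
      case (elim \<tau>)
      then show ?case
        using later[of \<tau>] c by (cases "s < \<tau> \<and> \<tau> \<le> T") (auto simp: indicator_def)
    qed
  qed
  also have "\<dots> = e T - e s" using FTC by (simp add: has_bochner_integral_iff)
  finally show False using above s' by simp
qed

lemma measurable_counts:
  fixes f :: "'x \<Rightarrow> ('m::finite) counts"
  assumes [measurable]: "\<And>q i. (\<lambda>x. f x q i) \<in> measurable M (count_space UNIV)"
  shows "f \<in> measurable M (count_space UNIV)"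
  unfolding measurable_count_space_eq2_countable
proof (intro conjI ballI)
  fix z
  have "f -` {z} \<inter> space M = {x \<in> space M. \<forall>q i. f x q i = z q i}"
    by (auto simp: fun_eq_iff)
  also have "\<dots> \<in> sets M" by measurable
  finally show "f -` {z} \<inter> space M \<in> sets M" .
qed simp

text \<open>
  The generator of the untruncated Markov chain with routing rule \<open>pol\<close>, applied to \<open>\<Phi>\<close>.
\<close>

definition drift :: "real^'m \<Rightarrow> real^'m \<Rightarrow> (('m::finite) counts \<Rightarrow> 'm \<Rightarrow> sys) \<Rightarrow>
    ('m counts \<Rightarrow> real) \<Rightarrow> 'm counts \<Rightarrow> real" where
  "drift lam mu pol \<Phi> z = (\<Sum>i\<in>UNIV. lam $ i * (\<Phi> (incr z (pol z i) i) - \<Phi> z)) +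
     (\<Sum>q\<in>UNIV. \<Sum>i\<in>UNIV. mu $ i * real (z q i) * (\<Phi> (decr z q i) - \<Phi> z))"

locale stochastic_system = truncated_system pol \<nu> K
  for pol :: "('m::finite) counts \<Rightarrow> 'm \<Rightarrow> sys" and \<nu> :: "'m counts" and K :: nat +
  fixes lam mu :: "real^'m"
  assumes lam_pos: "0 < lam $ i" and mu_pos: "0 < mu $ i"
begin

sublocale exp_clocks "clock_rate lam mu"
proof
  show "0 < clock_rate lam mu c" for c :: "'m clock"
    by (cases c) (auto simp: lam_pos mu_pos)
qed

text \<open>
  At each time at most one interarrival clock of a class runs, because the running intervals of
  consecutive ones are adjacent.
\<close>

lemma sum_active_Interarrival:
  assumes w: "\<And>c. 0 < w c"
  shows "(\<Sum>n<L. indicator {start w (Interarrival i n)<..ring w (Interarrival i n)} t) =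
    (indicator {0<..start w (Interarrival i L)} t :: real)"
proof (induction L)
  case (Suc L)
  have "0 \<le> start w (Interarrival i L)" "start w (Interarrival i L) \<le> ring w (Interarrival i L)"
    using w start_nonneg[of w, OF w] less_imp_le[OF w] by (auto simp: ring_def simp del: start.simps)
  then show ?case
    unfolding sum.lessThan_Suc Suc.IH start_Interarrival_Suc by (auto simp: indicator_def)
qed simp

text \<open>
  The predicted rate of change of \<open>\<Phi>\<close> at time \<open>t\<close>, clock by clock: each running clock
  contributes its rate times the jump that its ring would cause.
\<close>

definition jump_rate :: "('m counts \<Rightarrow> real) \<Rightarrow> ('m clock \<Rightarrow> real) \<Rightarrow> real \<Rightarrow> real" where
  "jump_rate \<Phi> w t = (\<Sum>c\<in>clocks. clock_rate lam mu c * (indicator {start w c<..ring w c} t *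
      (\<Phi> (fire w c (before w t)) - \<Phi> (before w t))))"

text \<open>
  The number of running service clocks of the chosen systems is the population itself, which
  yields the departure part of the generator.
\<close>

lemma jump_rate_eq:
  assumes w: "\<And>c. 0 < w c" and t: "0 < t"
  shows "jump_rate \<Phi> w t =
    (\<Sum>i\<in>UNIV. lam $ i * (indicator {0<..start w (Interarrival i K)} t *
        (\<Phi> (incr (before w t) (pol (before w t) i) i) - \<Phi> (before w t)))) +
    (\<Sum>q\<in>UNIV. \<Sum>i\<in>UNIV. mu $ i * real (before w t q i) * (\<Phi> (decr (before w t) q i) - \<Phi> (before w t)))"
proof -
  define z where "z = before w t"
  have serv: "(\<Sum>n<K. mu $ i * (indicator {start w (Service q i n)<..ring w (Service q i n)} t *
      (\<Phi> (fire w (Service q i n) z) - \<Phi> z))) +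
      (\<Sum>k<\<nu> q i. mu $ i * (indicator {start w (Residual q i k)<..ring w (Residual q i k)} t *
      (\<Phi> (fire w (Residual q i k) z) - \<Phi> z))) = mu $ i * real (z q i) * (\<Phi> (decr z q i) - \<Phi> z)"
    for q i
  proof -
    let ?D = "\<Phi> (decr z q i) - \<Phi> z"
    let ?A = "{n. n < K \<and> routing w i n = q \<and> ring w (Interarrival i n) < t \<and> \<not> ring w (Service q i n) < t}"
    let ?B = "{k. k < \<nu> q i \<and> \<not> ring w (Residual q i k) < t}"
    have "(\<Sum>n<K. mu $ i * (indicator {start w (Service q i n)<..ring w (Service q i n)} t *
      (\<Phi> (fire w (Service q i n) z) - \<Phi> z))) = (\<Sum>n<K. if n \<in> ?A then mu $ i * ?D else 0)"
      by (intro sum.cong) (auto simp: start_Service fire_def simp del: start.simps)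
    also have "\<dots> = (\<Sum>n\<in>{..<K} \<inter> ?A. mu $ i * ?D)"
      by (subst sum.inter_restrict[symmetric]) simp_all
    also have "{..<K} \<inter> ?A = ?A" by auto
    finally have 1: "(\<Sum>n<K. mu $ i * (indicator {start w (Service q i n)<..ring w (Service q i n)} t *
      (\<Phi> (fire w (Service q i n) z) - \<Phi> z))) = real (card ?A) * (mu $ i * ?D)" by simp
    have "(\<Sum>k<\<nu> q i. mu $ i * (indicator {start w (Residual q i k)<..ring w (Residual q i k)} t *
      (\<Phi> (fire w (Residual q i k) z) - \<Phi> z))) = (\<Sum>k<\<nu> q i. if k \<in> ?B then mu $ i * ?D else 0)"
      using t by (intro sum.cong) (auto simp: fire_def)
    also have "\<dots> = (\<Sum>k\<in>{..<\<nu> q i} \<inter> ?B. mu $ i * ?D)"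
      by (subst sum.inter_restrict[symmetric]) simp_all
    also have "{..<\<nu> q i} \<inter> ?B = ?B" by auto
    finally have 2: "(\<Sum>k<\<nu> q i. mu $ i * (indicator {start w (Residual q i k)<..ring w (Residual q i k)} t *
      (\<Phi> (fire w (Residual q i k) z) - \<Phi> z))) = real (card ?B) * (mu $ i * ?D)" by simp
    have "z q i = card ?B + card ?A" by (simp add: z_def before_def population_def)
    then show ?thesis unfolding 1 2 by (simp add: algebra_simps)
  qed
  have arr: "(\<Sum>n<K. lam $ i * (indicator {start w (Interarrival i n)<..ring w (Interarrival i n)} t *
      (\<Phi> (fire w (Interarrival i n) z) - \<Phi> z))) =
      lam $ i * (indicator {0<..start w (Interarrival i K)} t * (\<Phi> (incr z (pol z i) i) - \<Phi> z))" for i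
    unfolding sum_active_Interarrival[of w, OF w, symmetric]
    by (simp only: fire_def clock.case sum_distrib_left sum_distrib_right)
  show ?thesis
    unfolding jump_rate_def z_def[symmetric] sum_clocks clock_rate.simps arr serv ..
qed

lemma jump_rate_le_drift:
  assumes w: "\<And>c. 0 < w c" and t: "0 < t"
    and up: "\<And>z q i. \<Phi> z \<le> \<Phi> (incr z q i)"
  shows "jump_rate \<Phi> w t \<le> drift lam mu pol \<Phi> (before w t)"
  unfolding jump_rate_eq[of w, OF w t] drift_def
  using lam_pos up
  by (intro add_right_mono sum_mono mult_left_mono) (auto simp: indicator_def less_imp_le)

lemma start_measurable[measurable]: "(\<lambda>w. start w c) \<in> borel_measurable P"
  by (cases c) simp_all

lemma ring_measurable[measurable]: "(\<lambda>w. ring w c) \<in> borel_measurable P"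
  unfolding ring_def by measurable

lemma population_measurable:
  assumes [measurable]: "\<And>i n. (\<lambda>x. R x i n) \<in> measurable M (count_space UNIV)"
    and [measurable]: "\<And>c. Measurable.pred M (\<lambda>x. c \<in> F x)"
  shows "(\<lambda>x. population (R x) (F x)) \<in> measurable M (count_space UNIV)"
proof (rule measurable_counts)
  fix q i
  have "(\<lambda>x. card {k. k < \<nu> q i \<and> Residual q i k \<notin> F x} +
     card {n. n < K \<and> R x i n = q \<and> Interarrival i n \<in> F x \<and> Service q i n \<notin> F x})
     \<in> measurable M (count_space UNIV)"
    by measurable
  then show "(\<lambda>x. population (R x) (F x) q i) \<in> measurable M (count_space UNIV)"
    by (simp add: population_def)
qed

lemma route_measurable: "(\<lambda>w. route d w i n) \<in> measurable P (count_space UNIV)"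
proof (induction d arbitrary: i n)
  case (Suc d)
  note [measurable] = Suc
  have "(\<lambda>w. population (route d w) {c. ring w c < ring w (Interarrival i n)}) \<in> measurable P (count_space UNIV)"
    by (rule population_measurable) (use Suc in simp_all)
  then have "(\<lambda>w. (\<lambda>z. pol z i) (population (route d w) {c. ring w c < ring w (Interarrival i n)})) \<in> measurable P (count_space UNIV)"
    by (rule measurable_compose) simp
  then show ?case by simp
qed simp

lemma routing_measurable[measurable]: "(\<lambda>w. routing w i n) \<in> measurable P (count_space UNIV)"
  unfolding routing_def by (rule route_measurable)

lemma before_measurable[measurable]:
  "(\<lambda>x. before (fst x) (snd x)) \<in> measurable (P \<Otimes>\<^sub>M borel) (count_space UNIV)"
  unfolding before_def by (rule population_measurable) simp_all

lemma after_measurable[measurable]: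
  "(\<lambda>w. after w t) \<in> measurable P (count_space UNIV)"
  unfolding after_def by (rule population_measurable) simp_all

lemma fire_measurable[measurable]:
  "(\<lambda>x. fire (fst x) c (before (fst x) (snd x))) \<in> measurable (P \<Otimes>\<^sub>M borel) (count_space UNIV)"
proof -
  have *: "(\<lambda>x. f (before (fst x) (snd x))) \<in> measurable (P \<Otimes>\<^sub>M borel) (count_space UNIV)"
    for f :: "'m counts \<Rightarrow> 'm counts"
    by (rule measurable_compose[OF before_measurable]) simp
  show ?thesis
  proof (cases c)
    case (Interarrival i n)
    then show ?thesis using *[of "\<lambda>z. incr z (pol z i) i"] by (simp add: fire_def)
  next
    case (Service q i n)
    have "(\<lambda>x. if routing (fst x) i n = q then decr (before (fst x) (snd x)) q i else before (fst x) (snd x))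
      \<in> measurable (P \<Otimes>\<^sub>M borel) (count_space UNIV)"
      by (rule measurable_If[OF *[of "\<lambda>z. decr z q i"] *[of "\<lambda>z. z"]]) measurable
    then show ?thesis by (simp add: Service fire_def)
  next
    case (Residual q i n)
    then show ?thesis using *[of "\<lambda>z. decr z q i"] by (simp add: fire_def)
  qed
qed

text \<open>
  As long as the clock \<open>c\<close> runs, the jump that its ring would cause does not depend on how long it
  will still run. For a service clock this includes the routing decision, which was taken when the
  clock started.
\<close>

lemma fire_nonanticipating:
  assumes w: "\<And>c. 0 < w c" and t: "start w c < t" "t \<le> start w c + w c" "t \<le> start w c + v"
  shows "fire (w(c := v)) c (before (w(c := v)) t) = fire w c (before w t)"
    and "before (w(c := v)) t = before w t"
proof -
  have eq: "min t (ring (w(c := v)) c') = min t (ring w c')" for c'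
    by (rule ring_upd_beyond[OF w t])
  show bef: "before (w(c := v)) t = before w t"
    by (rule before_nonanticipating[OF eq])
  have "routing (w(c := v)) i n = routing w i n" if "c = Service q i n" for q i n
    unfolding routing_def using t that by (intro route_nonanticipating[OF eq]) (simp add: ring_simps)
  then show "fire (w(c := v)) c (before (w(c := v)) t) = fire w c (before w t)"
    unfolding bef by (auto simp: fire_def split: clock.split)
qed

lemma AE_resample:
  assumes Q[measurable]: "Measurable.pred P Q" and AE: "\<And>w. AE v in exp_law (clock_rate lam mu c). Q (w(c := v))"
  shows "AE w in P. Q w"
proof -
  have "(\<integral>\<^sup>+w. indicator {w. \<not> Q w} w \<partial>P) = (\<integral>\<^sup>+w. (\<integral>\<^sup>+v. indicator {w. \<not> Q w} (w(c := v)) \<partial>exp_law (clock_rate lam mu c)) \<partial>P)"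
    by (rule nn_integral_resample_P) measurable
  also have "\<dots> = (\<integral>\<^sup>+w. 0 \<partial>P)"
  proof (rule nn_integral_cong)
    fix w
    have "(\<integral>\<^sup>+v. indicator {w. \<not> Q w} (w(c := v)) \<partial>exp_law (clock_rate lam mu c))
      = (\<integral>\<^sup>+v. 0 \<partial>exp_law (clock_rate lam mu c))"
      by (rule nn_integral_cong_AE) (use AE[of w] in eventually_elim, auto)
    then show "(\<integral>\<^sup>+v. indicator {w. \<not> Q w} (w(c := v)) \<partial>exp_law (clock_rate lam mu c)) = 0" by simp
  qed
  finally have "(\<integral>\<^sup>+w. indicator {w. \<not> Q w} w \<partial>P) = 0" by simp
  then have "AE w in P. (indicator {w. \<not> Q w} w :: ennreal) = 0"
    by (subst (asm) nn_integral_0_iff_AE) auto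
  then show ?thesis by eventually_elim (auto simp: indicator_def split: if_splits)
qed

lemma AE_ring_neq: "AE w in P. ring w c \<noteq> t"
proof (rule AE_resample[where c=c])
  fix w
  show "AE v in exp_law (clock_rate lam mu c). ring (w(c := v)) c \<noteq> t"
    using AE_exp_law_neq[of "t - start w c"]
    by eventually_elim (auto simp: ring_def start_upd)
qed measurable

text \<open>
  Of two different clocks, one can always be resampled without moving the ring of the other; its
  ring time then has a density, so that a tie has probability zero.
\<close>

lemma AE_ring_inj: "AE w in P. inj_on (ring w) clocks"
proof -
  have one: "AE w in P. ring w c \<noteq> ring w c'" if "\<And>w v. ring (w(c := v)) c' = ring w c'" for c c'
  proof (rule AE_resample[where c=c])
    fix w
    show "AE v in exp_law (clock_rate lam mu c). ring (w(c := v)) c \<noteq> ring (w(c := v)) c'"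
      using AE_exp_law_neq[of "ring w c' - start w c"]
      by eventually_elim (auto simp: that, auto simp: ring_def start_upd)
  qed (unfold neq_iff, measurable)
  have "AE w in P. ring w c \<noteq> ring w c'" if "c \<noteq> c'" for c c'
  proof -
    have "(\<forall>w v. ring (w(c := v)) c' = ring w c') \<or> (\<forall>w v. ring (w(c' := v)) c = ring w c)"
    proof (cases "\<exists>i n j m. c = Interarrival i n \<and> c' = Interarrival j m")
      case True
      then obtain i n j m where "c = Interarrival i n" "c' = Interarrival j m" by auto
      then show ?thesis using that by (cases "i = j \<and> n < m") (auto simp: ring_simps intro!: sum.cong)
    next
      case False
      then show ?thesis using that by (cases c; cases c') (auto simp: ring_simps)
    qed
    then show ?thesis using one[of c c'] one[of c' c] by (auto simp: eq_commute)
  qed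
  then have "AE w in P. \<forall>c\<in>clocks. \<forall>c'\<in>clocks. c \<noteq> c' \<longrightarrow> ring w c \<noteq> ring w c'"
    using finite_clocks by (auto simp: AE_finite_all)
  then show ?thesis by eventually_elim (auto simp: inj_on_def)
qed

end

lemma finite_counts_le: "finite {z :: ('m::finite) counts. \<forall>q i. z q i \<le> b q i}"
proof (rule finite_subset)
  show "finite (Pi\<^sub>E UNIV (\<lambda>q. Pi\<^sub>E UNIV (\<lambda>i::'m. {..b q i :: nat})))"
    by (intro finite_PiE) auto
qed auto

context stochastic_system
begin

lemma population_le: "population R F q i \<le> \<nu> q i + K"
proof -
  have "card {k. k < \<nu> q i \<and> Residual q i k \<notin> F} \<le> card {..<\<nu> q i}"
    by (rule card_mono) auto
  moreover have "card {n. n < K \<and> R i n = q \<and> Interarrival i n \<in> F \<and> Service q i n \<notin> F} \<le> card {..<K}"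
    by (rule card_mono) auto
  ultimately show ?thesis by (simp add: population_def)
qed

lemma bounded_along_paths:
  fixes \<Phi> :: "'m counts \<Rightarrow> real"
  shows "\<exists>b. \<forall>R F. \<bar>\<Phi> (population R F)\<bar> \<le> b \<and> (\<forall>w c. \<bar>\<Phi> (fire w c (population R F))\<bar> \<le> b)"
proof -
  let ?Z = "{z :: 'm counts. \<forall>q i. z q i \<le> \<nu> q i + K + 1}"
  have Z: "population R F \<in> ?Z" "fire w c (population R F) \<in> ?Z" for R F w c
    using population_le[of R F]
    by (auto simp: fire_def incr_def decr_def le_SucI le_diff_conv intro: le_SucI split: clock.split)
  have bound: "\<bar>\<Phi> z\<bar> \<le> Max ((\<lambda>z. \<bar>\<Phi> z\<bar>) ` ?Z)" if "z \<in> ?Z" for z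
    using that by (intro Max_ge finite_imageI finite_counts_le imageI)
  show ?thesis by (intro exI allI conjI) (rule bound[OF Z(1)], rule bound[OF Z(2)])
qed

definition mean :: "('m counts \<Rightarrow> real) \<Rightarrow> real \<Rightarrow> real" where
  "mean \<Phi> t = (\<integral>w. \<Phi> (after w t) \<partial>P)"

lemma Phi_after_measurable[measurable]: "(\<lambda>w. \<Phi> (after w t) :: real) \<in> borel_measurable P"
  by (rule measurable_compose[OF after_measurable]) simp

lemma Phi_before_measurable[measurable]:
  "(\<lambda>x. \<Phi> (before (fst x) (snd x)) :: real) \<in> borel_measurable (P \<Otimes>\<^sub>M borel)"
  by (rule measurable_compose[OF before_measurable]) simp

lemma Phi_fire_measurable[measurable]:
  "(\<lambda>x. \<Phi> (fire (fst x) c (before (fst x) (snd x))) :: real) \<in> borel_measurable (P \<Otimes>\<^sub>M borel)"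
  by (rule measurable_compose[OF fire_measurable]) simp

lemma Phi_before_measurable1[measurable]: "(\<lambda>w. \<Phi> (before w t) :: real) \<in> borel_measurable P"
  using measurable_compose[OF _ Phi_before_measurable, of "\<lambda>w. (w, t)" P \<Phi>] by simp

lemma integrable_Phi_after: "integrable P (\<lambda>w. \<Phi> (after w t) :: real)"
proof -
  obtain b where b: "\<forall>R F. \<bar>\<Phi> (population R F)\<bar> \<le> b \<and> (\<forall>w c. \<bar>\<Phi> (fire w c (population R F))\<bar> \<le> b)"
    using bounded_along_paths[of \<Phi>] ..
  then have b1: "\<bar>\<Phi> (population R F)\<bar> \<le> b" and b2: "\<bar>\<Phi> (fire w c (population R F))\<bar> \<le> b" for R F w c
    by simp_all
  show ?thesis by (intro clk.integrable_const_bound[where B=b] Phi_after_measurable AE_I2) (simp add: after_def b1)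
qed

lemma integrable_Phi_before: "integrable P (\<lambda>w. \<Phi> (before w t) :: real)"
proof -
  obtain b where b: "\<forall>R F. \<bar>\<Phi> (population R F)\<bar> \<le> b \<and> (\<forall>w c. \<bar>\<Phi> (fire w c (population R F))\<bar> \<le> b)"
    using bounded_along_paths[of \<Phi>] ..
  then have b1: "\<bar>\<Phi> (population R F)\<bar> \<le> b" and b2: "\<bar>\<Phi> (fire w c (population R F))\<bar> \<le> b" for R F w c
    by simp_all
  show ?thesis by (intro clk.integrable_const_bound[where B=b] Phi_before_measurable1 AE_I2) (simp add: before_def b1)
qed

text \<open>
  A fixed time is almost surely not a ring time, so the left limit has the same expectation.
\<close>

lemma mean_eq_before: "mean \<Phi> t = (\<integral>w. \<Phi> (before w t) \<partial>P)"
  unfolding mean_def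
proof (rule integral_cong_AE)
  have "AE w in P. \<forall>c\<in>clocks. ring w c \<noteq> t"
    using finite_clocks by (auto simp: AE_finite_all AE_ring_neq)
  then show "AE w in P. \<Phi> (after w t) = \<Phi> (before w t)"
    by eventually_elim (subst after_eq_before_same, auto)
qed measurable

lemma mean_zero: "mean \<Phi> 0 = \<Phi> \<nu>"
proof -
  have "AE w in P. \<Phi> (after w 0) = \<Phi> \<nu>"
    using AE_pos
  proof eventually_elim
    case (elim w)
    then have pos: "0 < ring w c" for c
      using start_nonneg[of w c] by (auto simp: ring_def intro: add_nonneg_pos)
    have "after w 0 = \<nu>"
      by (intro ext) (simp add: after_def population_def not_le pos[unfolded not_le[symmetric]])
    then show ?case by simp
  qed
  then have "mean \<Phi> 0 = (\<integral>w. \<Phi> \<nu> \<partial>P)"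
    unfolding mean_def by (intro integral_cong_AE) auto
  then show ?thesis by (simp add: clk.prob_space[simplified])
qed

text \<open>
  The jumps of the telescoping sum are replaced, one clock at a time, by their compensators.
\<close>

lemma mean_increment:
  assumes st: "0 \<le> s" "s \<le> t"
  shows "integrable (P \<Otimes>\<^sub>M lborel) (\<lambda>(w, \<tau>). indicator {s<..t} \<tau> * jump_rate \<Phi> w \<tau>)" (is ?int)
    and "mean \<Phi> t - mean \<Phi> s =
      (\<integral>(w, \<tau>). indicator {s<..t} \<tau> * jump_rate \<Phi> w \<tau> \<partial>(P \<Otimes>\<^sub>M lborel))" (is ?eq)
proof -
  obtain b where b: "\<forall>R F. \<bar>\<Phi> (population R F)\<bar> \<le> b \<and> (\<forall>w c. \<bar>\<Phi> (fire w c (population R F))\<bar> \<le> b)"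
    using bounded_along_paths[of \<Phi>] ..
  then have b1: "\<bar>\<Phi> (population R F)\<bar> \<le> b" and b2: "\<bar>\<Phi> (fire w c (population R F))\<bar> \<le> b" for R F w c
    by simp_all
  define J where "J c w \<tau> = \<Phi> (fire w c (before w \<tau>)) - \<Phi> (before w \<tau>)" for c w \<tau>
  have J_bound: "\<bar>J c w \<tau>\<bar> \<le> 2 * b" for c w \<tau>
    using b1[of "routing w" "{c. ring w c < \<tau>}"] b2[of w c "routing w" "{c. ring w c < \<tau>}"]
    unfolding J_def before_def by linarith
  have J_meas: "(\<lambda>(w, \<tau>). J c w \<tau>) \<in> borel_measurable (P \<Otimes>\<^sub>M borel)" for c
    unfolding J_def case_prod_unfold by measurable
  have nonant: "J c (w(c := v)) \<tau> = J c w \<tau>"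
    if "\<forall>c. 0 < w c" "start w c < \<tau>" "\<tau> \<le> start w c + w c" "\<tau> \<le> start w c + v" for c w v \<tau>
    using fire_nonanticipating[of w c \<tau> v] that by (simp add: J_def)
  have comp: "integrable P (\<lambda>w. indicator {s<..t} (ring w c) * J c w (ring w c))"
    "integrable (P \<Otimes>\<^sub>M lborel) (\<lambda>(w, \<tau>). indicator {s<..t} \<tau> * (clock_rate lam mu c *
      (indicator {start w c<..ring w c} \<tau> * J c w \<tau>)))"
    "(\<integral>w. indicator {s<..t} (ring w c) * J c w (ring w c) \<partial>P) =
     (\<integral>(w, \<tau>). indicator {s<..t} \<tau> * (clock_rate lam mu c *
      (indicator {start w c<..ring w c} \<tau> * J c w \<tau>)) \<partial>(P \<Otimes>\<^sub>M lborel))" for c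
    unfolding ring_def
    by (rule compensator[where B="2 * b"]; fact start_measurable start_upd J_meas J_bound nonant)+
  have gen: "(\<lambda>(w, \<tau>). indicator {s<..t} \<tau> * jump_rate \<Phi> w \<tau>) =
    (\<lambda>x. \<Sum>c\<in>clocks. (\<lambda>(w, \<tau>). indicator {s<..t} \<tau> * (clock_rate lam mu c *
      (indicator {start w c<..ring w c} \<tau> * J c w \<tau>))) x)"
    by (auto simp: jump_rate_def J_def sum_distrib_left fun_eq_iff)
  show ?int
    unfolding gen by (intro Bochner_Integration.integrable_sum comp(2))
  have "mean \<Phi> t - mean \<Phi> s = (\<integral>w. \<Phi> (after w t) - \<Phi> (after w s) \<partial>P)"
    unfolding mean_def by (simp add: integrable_Phi_after)
  also have "\<dots> = (\<integral>w. (\<Sum>c\<in>clocks. indicator {s<..t} (ring w c) * J c w (ring w c)) \<partial>P)"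
  proof (rule integral_cong_AE)
    show "AE w in P. \<Phi> (after w t) - \<Phi> (after w s) =
        (\<Sum>c\<in>clocks. indicator {s<..t} (ring w c) * J c w (ring w c))"
      using AE_pos AE_ring_inj
      by eventually_elim (use st in \<open>simp add: after_telescope J_def\<close>)
    show "(\<lambda>w. \<Sum>c\<in>clocks. indicator {s<..t} (ring w c) * J c w (ring w c)) \<in> borel_measurable P"
      using comp(1) by (intro borel_measurable_sum) auto
  qed measurable
  also have "\<dots> = (\<Sum>c\<in>clocks. (\<integral>w. indicator {s<..t} (ring w c) * J c w (ring w c) \<partial>P))"
    by (intro Bochner_Integration.integral_sum comp(1))
  also have "\<dots> = (\<integral>(w, \<tau>). indicator {s<..t} \<tau> * jump_rate \<Phi> w \<tau> \<partial>(P \<Otimes>\<^sub>M lborel))"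
    unfolding gen comp(3) by (intro Bochner_Integration.integral_sum[symmetric] comp(2))
  finally show ?eq .
qed

lemma jump_rate_bounded:
  "\<exists>G\<ge>0. \<forall>w t. \<bar>jump_rate \<Phi> w t\<bar> \<le> G"
proof -
  obtain b where b: "\<forall>R F. \<bar>\<Phi> (population R F)\<bar> \<le> b \<and> (\<forall>w c. \<bar>\<Phi> (fire w c (population R F))\<bar> \<le> b)"
    using bounded_along_paths[of \<Phi>] ..
  then have b1: "\<bar>\<Phi> (population R F)\<bar> \<le> b" and b2: "\<bar>\<Phi> (fire w c (population R F))\<bar> \<le> b" for R F w c
    by simp_all
  have "\<bar>jump_rate \<Phi> w t\<bar> \<le> (\<Sum>c\<in>clocks. clock_rate lam mu c * (2 * b))" for w t
    unfolding jump_rate_def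
  proof (rule order_trans[OF sum_abs sum_mono])
    fix c
    have "\<bar>\<Phi> (fire w c (before w t)) - \<Phi> (before w t)\<bar> \<le> 2 * b"
      using b1[of "routing w" "{c. ring w c < t}"] b2[of w c "routing w" "{c. ring w c < t}"]
      unfolding before_def by linarith
    then show "\<bar>clock_rate lam mu c * (indicator {start w c<..ring w c} t *
      (\<Phi> (fire w c (before w t)) - \<Phi> (before w t)))\<bar> \<le> clock_rate lam mu c * (2 * b)"
      using r_pos[of c] by (auto simp: abs_mult indicator_def intro!: mult_left_mono)
  qed
  moreover have "0 \<le> \<bar>jump_rate \<Phi> undefined 0\<bar>" by simp
  ultimately show ?thesis by (intro exI[of _ "\<Sum>c\<in>clocks. clock_rate lam mu c * (2 * b)"]) (meson order_trans)
qed

interpretation pl: pair_sigma_finite P lborel ..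

lemma mean_increment_le:
  assumes st: "0 \<le> s" "s \<le> t"
    and up: "\<And>z q i. \<Phi> z \<le> \<Phi> (incr z q i)"
    and drift: "\<And>z. drift lam mu pol \<Phi> z \<le> c * (B - \<Phi> z)"
  shows "mean \<Phi> t - mean \<Phi> s \<le> (\<integral>\<tau>. indicator {s<..t} \<tau> * (c * (B - mean \<Phi> \<tau>)) \<partial>lborel)"
proof -
  obtain b where b: "\<forall>R F. \<bar>\<Phi> (population R F)\<bar> \<le> b \<and> (\<forall>w c. \<bar>\<Phi> (fire w c (population R F))\<bar> \<le> b)"
    using bounded_along_paths[of \<Phi>] ..
  then have b1: "\<bar>\<Phi> (population R F)\<bar> \<le> b" and b2: "\<bar>\<Phi> (fire w c (population R F))\<bar> \<le> b" for R F w c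
    by simp_all
  let ?Q = "\<lambda>(w, \<tau>). indicator {s<..t} \<tau> * (c * (B - \<Phi> (before w \<tau>)))"
  have Q_meas: "?Q \<in> borel_measurable (P \<Otimes>\<^sub>M lborel)"
    unfolding case_prod_unfold by measurable
  have Q_int: "integrable (P \<Otimes>\<^sub>M lborel) ?Q"
  proof (rule Bochner_Integration.integrable_bound[OF _ Q_meas])
    have "emeasure (P \<Otimes>\<^sub>M lborel) (UNIV \<times> {s<..t}) < \<infinity>"
      using st clk.emeasure_space_1 sets.top[of P] by (simp add: lborel.emeasure_pair_measure_Times)
    then show "integrable (P \<Otimes>\<^sub>M lborel) (\<lambda>x. \<bar>c\<bar> * (\<bar>B\<bar> + b) * indicator (UNIV \<times> {s<..t}) x)"
      using pair_measureI[of UNIV P "{s<..t}" lborel] sets.top[of P]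
      by (intro integrable_mult_right integrable_real_indicator) auto
    have "\<bar>B - \<Phi> (before w \<tau>)\<bar> \<le> \<bar>\<bar>B\<bar> + b\<bar>" for w \<tau>
      using b1[of "routing w" "{c. ring w c < \<tau>}"] unfolding before_def by linarith
    then show "AE x in P \<Otimes>\<^sub>M lborel. norm (?Q x) \<le> norm (\<bar>c\<bar> * (\<bar>B\<bar> + b) * indicator (UNIV \<times> {s<..t}) x)"
      by (intro AE_I2) (auto simp: indicator_def abs_mult intro!: mult_left_mono)
  qed
  have "mean \<Phi> t - mean \<Phi> s =
      (\<integral>x. (\<lambda>(w, \<tau>). indicator {s<..t} \<tau> * jump_rate \<Phi> w \<tau>) x \<partial>(P \<Otimes>\<^sub>M lborel))"
    by (rule mean_increment(2)[OF st])
  also have "\<dots> \<le> (\<integral>x. ?Q x \<partial>(P \<Otimes>\<^sub>M lborel))"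
  proof (rule integral_mono_AE[OF mean_increment(1)[OF st] Q_int])
    have "AE x in P \<Otimes>\<^sub>M lborel. \<forall>c. 0 < fst x c"
    proof (rule pl.AE_pair_measure)
      show "{x \<in> space (P \<Otimes>\<^sub>M lborel). \<forall>c. 0 < fst x c} \<in> sets (P \<Otimes>\<^sub>M lborel)" by measurable
      show "AE w in P. AE \<tau> in lborel. \<forall>c. 0 < fst (w, \<tau>) c"
        using AE_pos by eventually_elim simp
    qed
    then show "AE x in P \<Otimes>\<^sub>M lborel. (\<lambda>(w, \<tau>). indicator {s<..t} \<tau> * jump_rate \<Phi> w \<tau>) x \<le> ?Q x"
    proof eventually_elim
      case (elim x)
      obtain w \<tau> where x: "x = (w, \<tau>)" by (cases x)
      show ?case
      proof (cases "s < \<tau> \<and> \<tau> \<le> t")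
        case True
        then have "jump_rate \<Phi> w \<tau> \<le> drift lam mu pol \<Phi> (before w \<tau>)"
          using elim st x by (intro jump_rate_le_drift up) auto
        also note drift
        finally show ?thesis using True by (simp add: x)
      qed (auto simp: x indicator_def)
    qed
  qed
  also have "\<dots> = (\<integral>\<tau>. (\<integral>w. ?Q (w, \<tau>) \<partial>P) \<partial>lborel)"
    using pl.integral_snd[of "\<lambda>w \<tau>. ?Q (w, \<tau>)"] Q_int by simp
  also have "\<dots> = (\<integral>\<tau>. indicator {s<..t} \<tau> * (c * (B - mean \<Phi> \<tau>)) \<partial>lborel)"
    by (simp add: mean_eq_before integrable_Phi_before clk.prob_space[simplified])
  finally show ?thesis .
qed

text \<open>
  The jump rates are bounded, which makes the expectation Lipschitz in time.
\<close>

lemma mean_continuous: "continuous_on {0..T} (mean \<Phi>)"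
proof -
  obtain G where G: "0 \<le> G" "\<And>w t. \<bar>jump_rate \<Phi> w t\<bar> \<le> G" using jump_rate_bounded[of \<Phi>] by blast
  have *: "\<bar>mean \<Phi> t - mean \<Phi> s\<bar> \<le> G * (t - s)" if st: "0 \<le> s" "s \<le> t" for s t
  proof -
    have em: "emeasure (P \<Otimes>\<^sub>M lborel) (UNIV \<times> {s<..t}) = ennreal (t - s)"
      using st clk.emeasure_space_1 sets.top[of P] by (simp add: lborel.emeasure_pair_measure_Times)
    have S: "UNIV \<times> {s<..t} \<in> sets (P \<Otimes>\<^sub>M lborel)"
      using pair_measureI[of UNIV P "{s<..t}" lborel] sets.top[of P] by auto
    have "\<bar>mean \<Phi> t - mean \<Phi> s\<bar> \<le> (\<integral>x. G * indicator (UNIV \<times> {s<..t}) x \<partial>(P \<Otimes>\<^sub>M lborel))"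
      unfolding mean_increment(2)[OF st] real_norm_def[symmetric]
    proof (rule order_trans[OF integral_norm_bound integral_mono])
      show "integrable (P \<Otimes>\<^sub>M lborel) (\<lambda>x. norm (case x of (w, \<tau>) \<Rightarrow> indicator {s<..t} \<tau> * jump_rate \<Phi> w \<tau>))"
        by (intro integrable_norm mean_increment(1)[OF st])
      show "integrable (P \<Otimes>\<^sub>M lborel) (\<lambda>x. G * indicator (UNIV \<times> {s<..t}) x)"
        using S em by (intro integrable_mult_right integrable_real_indicator) auto
      show "norm (case x of (w, \<tau>) \<Rightarrow> indicator {s<..t} \<tau> * jump_rate \<Phi> w \<tau>) \<le> G * indicator (UNIV \<times> {s<..t}) x" for x
        using G by (auto simp: indicator_def split: prod.split)
    qed
    also have "\<dots> = G * (t - s)"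
      using S em st by (simp add: measure_def)
    finally show ?thesis .
  qed
  have "G-lipschitz_on {0..T} (mean \<Phi>)"
  proof (rule lipschitz_onI)
    fix x y assume "x \<in> {0..T}" "y \<in> {0..T}"
    then show "dist (mean \<Phi> x) (mean \<Phi> y) \<le> G * dist x y"
      using *[of x y] *[of y x] by (cases "x \<le> y") (auto simp: dist_real_def abs_minus_commute)
  qed (rule G)
  then show ?thesis by (rule lipschitz_on_continuous_on)
qed

text \<open>
  The bound is needed with its exponential term: for some initial populations \<open>\<Phi> \<nu>\<close> exceeds \<open>B\<close>, and
  only the average over the initial law is assumed to be below \<open>B\<close>. The right-hand side is affine in
  \<open>\<Phi> \<nu>\<close>, hence can be averaged.
\<close>

theorem mean_bound:
  assumes "0 \<le> T" "0 < c"
    and up: "\<And>z q i. \<Phi> z \<le> \<Phi> (incr z q i)"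
    and drift: "\<And>z. drift lam mu pol \<Phi> z \<le> c * (B - \<Phi> z)"
  shows "(\<integral>w. \<Phi> (after w T) \<partial>P) \<le> B + (\<Phi> \<nu> - B) * exp (- c * T)"
proof -
  have "mean \<Phi> T \<le> B + (mean \<Phi> 0 - B) * exp (- c * T)"
    using assms by (intro gronwall_affine mean_continuous mean_increment_le) auto
  then show ?thesis unfolding mean_zero unfolding mean_def .
qed

end

section \<open>A drift criterion for the given process\<close>

context stochastic_system
begin

text \<open>
  If all arrivals of a class came before \<open>T\<close>, all its interarrival times would be at most \<open>T\<close>; for
  the first \<open>L\<close> of them this has a probability that decays geometrically in \<open>L\<close>.
\<close>

lemma AE_arrivals_diverge: "AE w in P. \<forall>i. \<exists>n. T < ring w (Interarrival i n)"
  unfolding AE_all_countable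
proof
  fix i :: 'm
  define p where "p = measure (exp_law (lam $ i)) {..T}"
  interpret E: prob_space "exp_law (lam $ i)"
    by (rule prob_space_exponential_density[OF lam_pos])
  have p1: "p < 1"
  proof -
    have "0 < emeasure (exp_law (lam $ i)) {max T 0 + 1..}"
      by (subst emeasure_exp_law_ge[OF lam_pos]) auto
    then have pos: "0 < measure (exp_law (lam $ i)) {max T 0 + 1..}"
      by (simp add: E.emeasure_eq_measure)
    have "p + measure (exp_law (lam $ i)) {max T 0 + 1..} = measure (exp_law (lam $ i)) ({..T} \<union> {max T 0 + 1..})"
      unfolding p_def by (rule E.finite_measure_Union[symmetric]) auto
    also have "\<dots> \<le> 1" by (rule E.prob_le_1)
    finally show ?thesis using pos by linarith
  qed
  let ?A = "{w \<in> space P. \<forall>n. w (Interarrival i n) \<le> T}"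
  have A[measurable]: "?A \<in> sets P" by measurable
  have bound: "measure P ?A \<le> p ^ L" for L
  proof -
    let ?J = "Interarrival i ` {..<L}"
    have "emeasure P {w \<in> space P. \<forall>c\<in>?J. w c \<in> {..T}} = (\<Prod>c\<in>?J. emeasure (exp_law (clock_rate lam mu c)) {..T})"
      unfolding P_def by (rule emeasure_PiM_Collect) auto
    also have "\<dots> = (\<Prod>n<L. emeasure (exp_law (lam $ i)) {..T})"
      by (subst prod.reindex) (auto simp: inj_on_def)
    also have "\<dots> = ennreal (p ^ L)"
      by (simp add: p_def E.emeasure_eq_measure ennreal_power)
    finally have "emeasure P {w \<in> space P. \<forall>c\<in>?J. w c \<in> {..T}} = ennreal (p ^ L)" .
    moreover have "emeasure P ?A \<le> emeasure P {w \<in> space P. \<forall>c\<in>?J. w c \<in> {..T}}"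
    proof (rule emeasure_mono)
      show "{w \<in> space P. \<forall>c\<in>?J. w c \<in> {..T}} \<in> sets P"
        by (rule sets.sets_Collect_finite_All) (simp_all del: space_P)
    qed auto
    ultimately show ?thesis by (simp add: clk.emeasure_eq_measure p_def)
  qed
  have "(\<lambda>L. p ^ L) \<longlonglongrightarrow> 0"
    using p1 by (intro LIMSEQ_power_zero) (simp add: p_def)
  then have "measure P ?A \<le> 0"
    by (rule LIMSEQ_le_const) (use bound in auto)
  with measure_nonneg[of P ?A] have "measure P ?A = 0" by (rule antisym[rotated])
  then have "emeasure P ?A = 0" by (simp add: clk.emeasure_eq_measure)
  then have "AE w in P. \<not> (\<forall>n. w (Interarrival i n) \<le> T)"
    by (intro AE_I[of _ _ ?A] A) auto
  then show "AE w in P. \<exists>n. T < ring w (Interarrival i n)"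
    using AE_pos
  proof eventually_elim
    case (elim w)
    then obtain n where "T < w (Interarrival i n)" by (auto simp: not_le)
    then show ?case using start_nonneg[of w "Interarrival i n"] elim(2)
      by (intro exI[of _ n]) (simp add: ring_def)
  qed
qed

lemma nn_mean_bound:
  assumes T: "0 \<le> T" and c: "0 < c" and B: "0 \<le> B"
    and nonneg: "\<And>z. 0 \<le> \<Phi> z"
    and up: "\<And>z q i. \<Phi> z \<le> \<Phi> (incr z q i)"
    and drift: "\<And>z. drift lam mu pol \<Phi> z \<le> c * (B - \<Phi> z)"
  shows "(\<integral>\<^sup>+w. ennreal (\<Phi> (after w T)) \<partial>P) \<le>
    ennreal (B * (1 - exp (- c * T))) + ennreal (exp (- c * T)) * ennreal (\<Phi> \<nu>)"
proof -
  have "(\<integral>\<^sup>+w. ennreal (\<Phi> (after w T)) \<partial>P) = ennreal (\<integral>w. \<Phi> (after w T) \<partial>P)"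
    by (intro nn_integral_eq_integral integrable_Phi_after) (simp add: nonneg)
  also have "\<dots> \<le> ennreal (B + (\<Phi> \<nu> - B) * exp (- c * T))"
    by (intro ennreal_leI mean_bound T c up drift)
  also have "B + (\<Phi> \<nu> - B) * exp (- c * T) = B * (1 - exp (- c * T)) + exp (- c * T) * \<Phi> \<nu>"
    by (simp add: algebra_simps)
  also have "ennreal \<dots> = ennreal (B * (1 - exp (- c * T))) + ennreal (exp (- c * T)) * ennreal (\<Phi> \<nu>)"
    using T c B nonneg by (simp add: ennreal_plus ennreal_mult)
  finally show ?thesis .
qed

end

text \<open>
  When the arrivals that were cut off come after \<open>T\<close>, the truncated system follows the given process
  up to \<open>T\<close>: the given decisions satisfy the recursion of the policy, which has only one solution.
\<close>

lemma (in truncated_system) num_present_eq_after: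
  assumes w: "w = (\<lambda>c. W c \<omega>)" "\<And>c. 0 < W c \<omega>" and \<nu>: "\<nu> = N \<omega>"
    and K: "\<And>i. T < arrival_time W i K \<omega>"
    and R: "\<And>i n. R i n \<omega> = pol (\<lambda>q j. num_before W N R q j (arrival_time W i n \<omega>) \<omega>) i"
  shows "(\<lambda>q i. num_present W N R q i T \<omega>) = after w T"
proof -
  let ?R = "\<lambda>i n. R i n \<omega>"
  have arr: "arrival_time W i n \<omega> = ring w (Interarrival i n)" for i n
    by (simp add: arrival_time_def ring_simps w(1))
  have late: "n < K" if "ring w (Interarrival i n) \<le> T" for i n
  proof (rule ccontr)
    assume "\<not> n < K"
    then have "ring w (Interarrival i K) \<le> ring w (Interarrival i n)"
      using w by (intro ring_Interarrival_mono) auto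
    then show False using that K[of i] by (simp add: arr)
  qed
  have before: "(\<lambda>q i. num_before W N R q i t \<omega>) = population ?R {c. ring w c < t}" if "t \<le> T" for t
  proof (intro ext)
    fix q i
    have "{k. k < N \<omega> q i \<and> t \<le> W (Residual q i k) \<omega>} = {k. k < \<nu> q i \<and> Residual q i k \<notin> {c. ring w c < t}}"
      by (auto simp: \<nu> ring_simps w(1))
    moreover have "{n. R i n \<omega> = q \<and> arrival_time W i n \<omega> < t \<and>
              t \<le> arrival_time W i n \<omega> + W (Service q i n) \<omega>} =
       {n. n < K \<and> ?R i n = q \<and> Interarrival i n \<in> {c. ring w c < t} \<and> Service q i n \<notin> {c. ring w c < t}}"
      using that late[of i] by (auto simp: arr ring_simps(2) w(1) not_less)
    ultimately show "num_before W N R q i t \<omega> = population ?R {c. ring w c < t} q i"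
      by (simp add: num_before_def population_def)
  qed
  have present: "(\<lambda>q i. num_present W N R q i T \<omega>) = population ?R {c. ring w c \<le> T}"
  proof (intro ext)
    fix q i
    have "{k. k < N \<omega> q i \<and> T < W (Residual q i k) \<omega>} = {k. k < \<nu> q i \<and> Residual q i k \<notin> {c. ring w c \<le> T}}"
      by (auto simp: \<nu> ring_simps w(1))
    moreover have "{n. R i n \<omega> = q \<and> arrival_time W i n \<omega> \<le> T \<and>
              T < arrival_time W i n \<omega> + W (Service q i n) \<omega>} =
       {n. n < K \<and> ?R i n = q \<and> Interarrival i n \<in> {c. ring w c \<le> T} \<and> Service q i n \<notin> {c. ring w c \<le> T}}"
      using late[of i] by (auto simp: arr ring_simps(2) w(1) not_le)
    ultimately show "num_present W N R q i T \<omega> = population ?R {c. ring w c \<le> T} q i"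
      by (simp add: num_present_def population_def)
  qed
  have "routing w i n = ?R i n" if "n < K" "ring w (Interarrival i n) \<le> T" for i n
  proof (rule routing_unique[OF _ that])
    fix i n assume "ring w (Interarrival i n) \<le> T"
    then show "?R i n = pol (population ?R {c. ring w c < ring w (Interarrival i n)}) i"
      using before[of "ring w (Interarrival i n)"] R[of i n] by (simp add: arr)
  qed
  then show ?thesis
    unfolding present after_def by (intro population_cong) auto
qed

text \<open>
  The initial populations and the clocks are distributed as an independent pair whose second
  component has the canonical law, so the expectation can be computed on the product space, for
  one initial population at a time.
\<close>

lemma driving_clocks_joint_law:
  assumes clocks: "driving_clocks M lam mu W N"
    and lam: "\<And>i. 0 < lam $ i" and mu: "\<And>i. 0 < mu $ i"
  defines "P \<equiv> PiM UNIV (\<lambda>c. exp_law (clock_rate lam mu c))"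
  shows "N \<in> measurable M (count_space UNIV)"
    and "(\<lambda>\<omega> c. W c \<omega>) \<in> measurable M P"
    and "distr M P (\<lambda>\<omega> c. W c \<omega>) = P"
    and "distr M (count_space UNIV \<Otimes>\<^sub>M P) (\<lambda>\<omega>. (N \<omega>, \<lambda>c. W c \<omega>)) = distr M (count_space UNIV) N \<Otimes>\<^sub>M P"
proof -
  interpret prob_space M using clocks by (simp add: driving_clocks_def)
  let ?X = "\<lambda>\<omega> c. W c \<omega>"
  have dist: "distributed M lborel (W c) (\<lambda>t. ennreal (exponential_density (clock_rate lam mu c) t))" for c
    using clocks by (simp add: driving_clocks_def)
  have W[measurable]: "W c \<in> borel_measurable M" for c
    using distributed_measurable[OF dist[of c]] by simp
  have law: "distr M borel (W c) = exp_law (clock_rate lam mu c)" for c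
    using distributed_distr_eq_density[OF dist[of c]] by (simp cong: distr_cong)
  have sets_P: "sets P = sets (PiM UNIV (\<lambda>_. borel))"
    unfolding P_def by (intro sets_PiM_cong) auto
  have X[measurable]: "?X \<in> measurable M (PiM UNIV (\<lambda>_. borel))"
    by (rule measurable_PiM_single') (auto simp: space_PiM)
  show N[measurable]: "N \<in> measurable M (count_space UNIV)"
    using clocks by (simp add: driving_clocks_def)
  show XP[measurable]: "?X \<in> measurable M P"
    using X by (simp add: sets_P cong: measurable_cong_sets)
  have "distr M (PiM UNIV (\<lambda>_. borel)) (\<lambda>\<omega>. \<lambda>c\<in>UNIV. W c \<omega>) = PiM UNIV (\<lambda>c. distr M borel (W c))"
    using clocks by (subst indep_vars_iff_distr_eq_PiM[symmetric]) (auto simp: driving_clocks_def)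
  then have PX: "distr M (PiM UNIV (\<lambda>_. borel)) ?X = P"
    by (simp add: law P_def restrict_UNIV)
  show PX': "distr M P ?X = P"
    unfolding PX[symmetric] by (intro distr_cong) (simp_all add: sets_P PX)
  interpret NN: prob_space "distr M (count_space UNIV) N" by (rule prob_space_distr) (rule N)
  have "prob_space (distr M P ?X)" by (rule prob_space_distr) (rule XP)
  then interpret PP: prob_space P by (simp only: PX')
  have "distr M (count_space UNIV) N \<Otimes>\<^sub>M P = distr M (count_space UNIV \<Otimes>\<^sub>M P) (\<lambda>\<omega>. (N \<omega>, ?X \<omega>))"
  proof (rule pair_measure_eqI)
    fix A B assume A: "A \<in> sets (distr M (count_space UNIV) N)" and B[measurable]: "B \<in> sets P"
    have "N -` A \<inter> space M \<in> sets (vimage_algebra (space M) N (count_space UNIV))"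
      "?X -` B \<inter> space M \<in> sets (vimage_algebra (space M) ?X (PiM UNIV (\<lambda>_. borel)))"
      using A B by (auto intro!: in_vimage_algebra simp: sets_P[symmetric])
    then have "prob ((N -` A \<inter> space M) \<inter> (?X -` B \<inter> space M)) =
        prob (N -` A \<inter> space M) * prob (?X -` B \<inter> space M)"
      using clocks by (intro indep_setD) (auto simp: driving_clocks_def)
    moreover have "(\<lambda>\<omega>. (N \<omega>, ?X \<omega>)) -` (A \<times> B) \<inter> space M = (N -` A \<inter> space M) \<inter> (?X -` B \<inter> space M)"
      by auto
    moreover have "emeasure P B = emeasure (distr M P ?X) B" by (simp add: PX')
    ultimately show "emeasure (distr M (count_space UNIV) N) A * emeasure P B =
        emeasure (distr M (count_space UNIV \<Otimes>\<^sub>M P) (\<lambda>\<omega>. (N \<omega>, ?X \<omega>))) (A \<times> B)"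
      using A by (simp add: emeasure_distr emeasure_eq_measure ennreal_mult)
  qed (unfold_locales, simp add: sets_pair_measure_cong[OF sets_distr refl])
  then show "distr M (count_space UNIV \<Otimes>\<^sub>M P) (\<lambda>\<omega>. (N \<omega>, ?X \<omega>)) = distr M (count_space UNIV) N \<Otimes>\<^sub>M P" ..
qed

text \<open>
  A Foster-Lyapunov bound for any routing rule that depends on the state alone. For each
  initial population the truncated systems satisfy the estimate \<open>mean_bound\<close>, whose average over the
  initial law is
  \<open>B * (1 - x) + x * E\<close> with \<open>x = exp (- c * T)\<close> and \<open>E \<le> B\<close> the initial mean, which is at most
  \<open>B\<close>. As \<open>K\<close> grows, the truncated population at \<open>T\<close> is eventually equal to the given one, and
  Fatou's lemma carries the bound over.
\<close>

theorem lyapunov_bound: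
  fixes pol :: "('m::finite) counts \<Rightarrow> 'm \<Rightarrow> sys" and \<Phi> :: "'m counts \<Rightarrow> real"
  assumes lam: "\<And>i. 0 < lam $ i" and mu: "\<And>i. 0 < mu $ i"
    and clocks: "driving_clocks M lam mu W N"
    and policy: "AE \<omega> in M. \<forall>i n. R i n \<omega> =
      pol (\<lambda>q j. num_before W N R q j (arrival_time W i n \<omega>) \<omega>) i"
    and c: "0 < c" and B: "0 \<le> B"
    and nonneg: "\<And>z. 0 \<le> \<Phi> z"
    and up: "\<And>z q i. \<Phi> z \<le> \<Phi> (incr z q i)"
    and drift: "\<And>z. drift lam mu pol \<Phi> z \<le> c * (B - \<Phi> z)"
    and initial: "(\<integral>\<^sup>+\<omega>. ennreal (\<Phi> (\<lambda>q i. num_present W N R q i 0 \<omega>)) \<partial>M) \<le> ennreal B"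
    and T: "0 \<le> T"
  shows "(\<integral>\<^sup>+\<omega>. ennreal (\<Phi> (\<lambda>q i. num_present W N R q i T \<omega>)) \<partial>M) \<le> ennreal B"
proof -
  interpret M: prob_space M using clocks by (simp add: driving_clocks_def)
  have sys: "stochastic_system lam mu"
    using lam mu by unfold_locales
  define P where "P = PiM UNIV (\<lambda>c. exp_law (clock_rate lam mu c))"
  interpret s: stochastic_system pol undefined 0 lam mu by (rule sys)
  have P: "s.P = P" by (simp add: s.P_def P_def)
  interpret P: prob_space P unfolding P[symmetric] by unfold_locales
  note joint = driving_clocks_joint_law[OF clocks lam mu, folded P_def]
  note [measurable] = joint(1,2)
  define A where "A = (\<lambda>K \<nu> w. truncated_system.after pol \<nu> K w T)"
  have A_meas[measurable]: "A K \<nu> \<in> measurable P (count_space UNIV)" for K \<nu>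
  proof -
    interpret t: stochastic_system pol \<nu> K lam mu by (rule sys)
    show ?thesis using t.after_measurable[of T] by (simp add: A_def P)
  qed
  have joint_meas[measurable]: "(\<lambda>x. ennreal (\<Phi> (A K (fst x) (snd x)))) \<in> borel_measurable (count_space UNIV \<Otimes>\<^sub>M P)" for K
    by (rule measurable_pair_measure_countable1) auto
  have pos: "AE \<omega> in M. \<forall>c. 0 < W c \<omega>"
  proof -
    have "AE w in distr M P (\<lambda>\<omega> c. W c \<omega>). \<forall>c. 0 < w c"
      using s.AE_pos unfolding joint(3) P .
    then show ?thesis by (rule AE_distrD[OF joint(2)])
  qed
  have div: "AE \<omega> in M. \<forall>i. \<exists>n. T < arrival_time W i n \<omega>"
  proof -
    have "AE w in distr M P (\<lambda>\<omega> c. W c \<omega>). \<forall>i. \<exists>n. T < ring w (Interarrival i n)"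
      using s.AE_arrivals_diverge[of T] unfolding joint(3) P .
    then have "AE \<omega> in M. \<forall>i. \<exists>n. T < ring (\<lambda>c. W c \<omega>) (Interarrival i n)"
      by (rule AE_distrD[OF joint(2)])
    then show ?thesis by (simp add: arrival_time_def ring_simps)
  qed
  have init: "(\<integral>\<^sup>+\<omega>. ennreal (\<Phi> (N \<omega>)) \<partial>M) \<le> ennreal B"
  proof -
    have "(\<integral>\<^sup>+\<omega>. ennreal (\<Phi> (N \<omega>)) \<partial>M) = (\<integral>\<^sup>+\<omega>. ennreal (\<Phi> (\<lambda>q i. num_present W N R q i 0 \<omega>)) \<partial>M)"
    proof (rule nn_integral_cong_AE)
      show "AE \<omega> in M. ennreal (\<Phi> (N \<omega>)) = ennreal (\<Phi> (\<lambda>q i. num_present W N R q i 0 \<omega>))"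
        using pos
      proof eventually_elim
        case (elim \<omega>)
        have "\<not> arrival_time W i n \<omega> \<le> 0" for i n
          unfolding arrival_time_def not_le using elim by (intro sum_pos) auto
        then have "(\<lambda>q i. num_present W N R q i 0 \<omega>) = N \<omega>"
          using elim by (intro ext) (simp add: num_present_def)
        then show ?case by simp
      qed
    qed
    then show ?thesis using initial by simp
  qed
  have trunc: "(\<integral>\<^sup>+\<omega>. ennreal (\<Phi> (A K (N \<omega>) (\<lambda>c. W c \<omega>))) \<partial>M) \<le> ennreal B" for K
  proof -
    let ?x = "exp (- c * T)"
    have "(\<integral>\<^sup>+\<omega>. ennreal (\<Phi> (A K (N \<omega>) (\<lambda>c. W c \<omega>))) \<partial>M) =
      (\<integral>\<^sup>+x. ennreal (\<Phi> (A K (fst x) (snd x))) \<partial>distr M (count_space UNIV \<Otimes>\<^sub>M P) (\<lambda>\<omega>. (N \<omega>, \<lambda>c. W c \<omega>)))"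
      by (subst nn_integral_distr) simp_all
    also have "\<dots> = (\<integral>\<^sup>+\<nu>. (\<integral>\<^sup>+w. ennreal (\<Phi> (A K \<nu> w)) \<partial>P) \<partial>distr M (count_space UNIV) N)"
      unfolding joint(4) by (subst P.nn_integral_fst[symmetric]) (simp_all cong: measurable_cong_sets sets_pair_measure_cong)
    also have "\<dots> \<le> (\<integral>\<^sup>+\<nu>. ennreal (B * (1 - ?x)) + ennreal ?x * ennreal (\<Phi> \<nu>) \<partial>distr M (count_space UNIV) N)"
    proof (rule nn_integral_mono)
      fix \<nu>
      interpret t: stochastic_system pol \<nu> K lam mu by (rule sys)
      show "(\<integral>\<^sup>+w. ennreal (\<Phi> (A K \<nu> w)) \<partial>P) \<le> ennreal (B * (1 - ?x)) + ennreal ?x * ennreal (\<Phi> \<nu>)"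
        using t.nn_mean_bound[OF T c B nonneg up drift] by (simp add: A_def P)
    qed
    also have "\<dots> = (\<integral>\<^sup>+\<omega>. ennreal (B * (1 - ?x)) + ennreal ?x * ennreal (\<Phi> (N \<omega>)) \<partial>M)"
      by (subst nn_integral_distr) simp_all
    also have "\<dots> = ennreal (B * (1 - ?x)) + ennreal ?x * (\<integral>\<^sup>+\<omega>. ennreal (\<Phi> (N \<omega>)) \<partial>M)"
      by (subst nn_integral_add) (simp_all add: nn_integral_cmult M.emeasure_space_1)
    also have "\<dots> \<le> ennreal (B * (1 - ?x)) + ennreal ?x * ennreal B"
      using init by (intro add_left_mono mult_left_mono) auto
    also have "\<dots> = ennreal (B * (1 - ?x) + ?x * B)"
      using B c T by (simp add: ennreal_plus ennreal_mult)
    also have "B * (1 - ?x) + ?x * B = B" by (simp add: algebra_simps)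
    finally show ?thesis .
  qed
  have "(\<integral>\<^sup>+\<omega>. ennreal (\<Phi> (\<lambda>q i. num_present W N R q i T \<omega>)) \<partial>M)
    = (\<integral>\<^sup>+\<omega>. liminf (\<lambda>K. ennreal (\<Phi> (A K (N \<omega>) (\<lambda>c. W c \<omega>)))) \<partial>M)"
  proof (rule nn_integral_cong_AE)
    show "AE \<omega> in M. ennreal (\<Phi> (\<lambda>q i. num_present W N R q i T \<omega>)) =
        liminf (\<lambda>K. ennreal (\<Phi> (A K (N \<omega>) (\<lambda>c. W c \<omega>))))"
      using pos div policy
    proof eventually_elim
      case (elim \<omega>)
      from elim(2) obtain n where n: "\<And>i. T < arrival_time W i (n i) \<omega>" by metis
      have "eventually (\<lambda>K. ennreal (\<Phi> (A K (N \<omega>) (\<lambda>c. W c \<omega>))) =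
          ennreal (\<Phi> (\<lambda>q i. num_present W N R q i T \<omega>))) sequentially"
      proof (rule eventually_sequentiallyI)
        fix K assume K: "Max (range n) \<le> K"
        interpret t: truncated_system pol "N \<omega>" K .
        have "T < arrival_time W i K \<omega>" for i
        proof -
          have "n i \<le> K" using K by (auto simp: Max_le_iff)
          then have "arrival_time W i (n i) \<omega> \<le> arrival_time W i K \<omega>"
            using elim(1) ring_Interarrival_mono[of "\<lambda>c. W c \<omega>" "n i" K i]
            by (simp add: arrival_time_def ring_simps)
          then show ?thesis using n[of i] by linarith
        qed
        then have "(\<lambda>q i. num_present W N R q i T \<omega>) = A K (N \<omega>) (\<lambda>c. W c \<omega>)"
          unfolding A_def using elim by (intro t.num_present_eq_after) auto
        then show "ennreal (\<Phi> (A K (N \<omega>) (\<lambda>c. W c \<omega>))) =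
          ennreal (\<Phi> (\<lambda>q i. num_present W N R q i T \<omega>))" by simp
      qed
      then have "(\<lambda>K. ennreal (\<Phi> (A K (N \<omega>) (\<lambda>c. W c \<omega>)))) \<longlonglongrightarrow>
          ennreal (\<Phi> (\<lambda>q i. num_present W N R q i T \<omega>))"
        by (rule tendsto_eventually)
      then show ?case by (intro lim_imp_Liminf[symmetric]) simp_all
    qed
  qed
  also have "\<dots> \<le> liminf (\<lambda>K. \<integral>\<^sup>+\<omega>. ennreal (\<Phi> (A K (N \<omega>) (\<lambda>c. W c \<omega>))) \<partial>M)"
  proof (rule nn_integral_liminf)
    fix K
    have "(\<lambda>\<omega>. (N \<omega>, \<lambda>c. W c \<omega>)) \<in> measurable M (count_space UNIV \<Otimes>\<^sub>M P)" by measurable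
    from measurable_compose[OF this joint_meas]
    show "(\<lambda>\<omega>. ennreal (\<Phi> (A K (N \<omega>) (\<lambda>c. W c \<omega>)))) \<in> borel_measurable M" by simp
  qed
  also have "\<dots> \<le> ennreal B"
    by (rule Liminf_le) (simp_all add: trunc)
  finally show ?thesis .
qed

section \<open>The drift of an exponential penalty\<close>

lemma exp_minus_le: "exp (- x) \<le> 1 - x + x\<^sup>2 / 2" if "0 \<le> x" for x :: real
proof -
  have "1 \<le> (1 + x + x\<^sup>2 / 2) * (1 - x + x\<^sup>2 / 2)"
    using that by (auto simp: algebra_simps power2_eq_square intro!: mult_nonneg_nonneg)
  also have "\<dots> \<le> exp x * (1 - x + x\<^sup>2 / 2)"
  proof (rule mult_right_mono)
    show "1 + x + x\<^sup>2 / 2 \<le> exp x" using that by (rule exp_lower_Taylor_quadratic)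
    have "0 \<le> (1 - x)\<^sup>2 + 1" by simp
    then show "0 \<le> 1 - x + x\<^sup>2 / 2" by (simp add: power2_eq_square algebra_simps)
  qed
  finally show ?thesis by (simp add: exp_minus field_simps)
qed

text \<open>
  The two estimates below bound the effect of one arrival and of one departure by the derivative,
  up to a factor close to 1, as soon as each request changes the exponent by at most \<open>\<epsilon>\<close>.
\<close>

lemma exp_increment_le:
  fixes x :: real
  assumes "0 \<le> x" "x \<le> \<epsilon>" "\<epsilon> \<le> 1"
  shows "exp x - 1 \<le> (1 + \<epsilon>) * x"
proof -
  have "exp x \<le> 1 + x + x\<^sup>2" using assms by (intro exp_bound) auto
  moreover have "x\<^sup>2 \<le> \<epsilon> * x" using assms by (simp add: power2_eq_square mult_right_mono)
  ultimately show ?thesis by (simp add: algebra_simps)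
qed

lemma exp_decrement_le:
  fixes x :: real
  assumes "0 \<le> x" "x \<le> \<epsilon>"
  shows "exp (- x) - 1 \<le> - (1 - \<epsilon> / 2) * x"
proof -
  have "x\<^sup>2 \<le> \<epsilon> * x" using assms by (simp add: power2_eq_square mult_right_mono)
  then show ?thesis using exp_minus_le[OF assms(1)] by (simp add: algebra_simps)
qed

definition exp_penalty :: "('s::finite \<Rightarrow> sys \<Rightarrow> ('m::finite) \<Rightarrow> real) \<Rightarrow> (sys \<Rightarrow> 'm \<Rightarrow> real) \<Rightarrow> real" where
  "exp_penalty e x = (\<Sum>j\<in>UNIV. exp (\<Sum>q\<in>UNIV. \<Sum>i\<in>UNIV. e j q i * x q i))"

text \<open>
  The partial derivative of \<open>exp_penalty e\<close> with respect to the coordinate \<open>(q, i)\<close>.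
\<close>

definition marginal :: "('s::finite \<Rightarrow> sys \<Rightarrow> ('m::finite) \<Rightarrow> real) \<Rightarrow> (sys \<Rightarrow> 'm \<Rightarrow> real) \<Rightarrow> sys \<Rightarrow> 'm \<Rightarrow> real" where
  "marginal e x q i = (\<Sum>j\<in>UNIV. exp (\<Sum>q\<in>UNIV. \<Sum>i\<in>UNIV. e j q i * x q i) * e j q i)"

abbreviation real_counts :: "'m counts \<Rightarrow> sys \<Rightarrow> 'm \<Rightarrow> real" where
  "real_counts z \<equiv> \<lambda>q i. real (z q i)"

lemma linear_shift:
  fixes e x y :: "sys \<Rightarrow> ('m::finite) \<Rightarrow> real"
  assumes "\<And>p j. y p j = x p j + (if p = q \<and> j = i then d else 0)"
  shows "(\<Sum>p\<in>UNIV. \<Sum>j\<in>UNIV. e p j * y p j) = (\<Sum>p\<in>UNIV. \<Sum>j\<in>UNIV. e p j * x p j) + d * e q i"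
proof -
  have "(\<Sum>p\<in>UNIV. \<Sum>j\<in>UNIV. e p j * (if p = q \<and> j = i then d else 0)) =
    (\<Sum>p\<in>UNIV. if p = q then (\<Sum>j\<in>UNIV. if j = i then d * e q i else 0) else 0)"
    by (intro sum.cong refl) (auto simp: if_distrib cong: if_cong intro!: sum.cong)
  also have "\<dots> = d * e q i" by simp
  finally show ?thesis unfolding assms by (simp add: distrib_left sum.distrib)
qed

lemma exp_penalty_shift:
  assumes "\<And>p j. y p j = x p j + (if p = q \<and> j = i then d else 0)"
  shows "exp_penalty e y - exp_penalty e x =
    (\<Sum>k\<in>UNIV. exp (\<Sum>q\<in>UNIV. \<Sum>i\<in>UNIV. e k q i * x q i) * (exp (d * e k q i) - 1))"
  unfolding exp_penalty_def linear_shift[OF assms]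
  by (simp add: exp_add right_diff_distrib sum_subtractf)

lemma exp_penalty_incr:
  "exp_penalty e (real_counts (incr z q i)) - exp_penalty e (real_counts z) =
    (\<Sum>k\<in>UNIV. exp (\<Sum>q\<in>UNIV. \<Sum>i\<in>UNIV. e k q i * real (z q i)) * (exp (e k q i) - 1))"
  by (subst exp_penalty_shift[where q=q and i=i and d=1]) (auto simp: incr_def)

lemma exp_penalty_decr:
  assumes "0 < z q i"
  shows "exp_penalty e (real_counts (decr z q i)) - exp_penalty e (real_counts z) =
    (\<Sum>k\<in>UNIV. exp (\<Sum>q\<in>UNIV. \<Sum>i\<in>UNIV. e k q i * real (z q i)) * (exp (- e k q i) - 1))"
  using assms by (subst exp_penalty_shift[where q=q and i=i and d="-1"]) (auto simp: decr_def)

lemma sum_marginal: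
  "(\<Sum>q\<in>UNIV. \<Sum>i\<in>UNIV. marginal e x q i * y q i) =
    (\<Sum>k\<in>UNIV. exp (\<Sum>q\<in>UNIV. \<Sum>i\<in>UNIV. e k q i * x q i) * (\<Sum>q\<in>UNIV. \<Sum>i\<in>UNIV. e k q i * y q i))"
proof -
  let ?E = "\<lambda>k. exp (\<Sum>q\<in>UNIV. \<Sum>i\<in>UNIV. e k q i * x q i)"
  have "(\<Sum>q\<in>UNIV. \<Sum>i\<in>UNIV. marginal e x q i * y q i) =
    (\<Sum>q\<in>UNIV. \<Sum>i\<in>UNIV. \<Sum>k\<in>UNIV. ?E k * (e k q i * y q i))"
    by (simp only: marginal_def sum_distrib_right mult.assoc)
  also have "\<dots> = (\<Sum>q\<in>UNIV. \<Sum>k\<in>UNIV. \<Sum>i\<in>UNIV. ?E k * (e k q i * y q i))"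
    by (intro sum.cong refl sum.swap)
  also have "\<dots> = (\<Sum>k\<in>UNIV. \<Sum>q\<in>UNIV. \<Sum>i\<in>UNIV. ?E k * (e k q i * y q i))"
    by (rule sum.swap)
  finally show ?thesis by (simp add: sum_distrib_left)
qed

lemma exp_penalty_convex:
  "(\<Sum>q\<in>UNIV. \<Sum>i\<in>UNIV. marginal e x q i * (y q i - x q i)) \<le> exp_penalty e y - exp_penalty e x"
proof -
  have tangent: "exp a * (b - a) \<le> exp b - exp a" for a b :: real
  proof -
    have "exp a * (1 + (b - a)) \<le> exp a * exp (b - a)"
      by (intro mult_left_mono) (use exp_ge_add_one_self[of "b - a"] in auto)
    then show ?thesis by (simp add: exp_diff algebra_simps)
  qed
  have lin: "(\<Sum>q\<in>UNIV. \<Sum>i\<in>UNIV. e k q i * (y q i - x q i)) =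
      (\<Sum>q\<in>UNIV. \<Sum>i\<in>UNIV. e k q i * y q i) - (\<Sum>q\<in>UNIV. \<Sum>i\<in>UNIV. e k q i * x q i)" for k
    by (simp add: right_diff_distrib sum_subtractf)
  show ?thesis
    unfolding sum_marginal lin exp_penalty_def
    by (subst sum_subtractf[symmetric], intro sum_mono tangent)
qed

text \<open>
  The routing rule picks the smaller marginal, hence arrivals of class \<open>i\<close> cost at most what
  they would cost if they were split in the proportions of \<open>xs\<close>; since the rate \<open>lam $ i\<close> is \<open>mu $ i\<close>
  times the total of \<open>xs\<close> over both systems, arrivals and departures together contribute at most,
  up to a factor, the derivative in the direction from \<open>z\<close> to a multiple of \<open>xs\<close>. Convexity bounds this by a difference of
  penalties. The factor \<open>1 + 3 * \<epsilon>\<close> absorbs the second-order terms, as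
  \<open>1 + \<epsilon> \<le> (1 - \<epsilon> / 2) * (1 + 3 * \<epsilon>)\<close>, and \<open>mmax / mmin\<close> the different service rates.
\<close>

lemma exp_penalty_drift:
  fixes e :: "'s::finite \<Rightarrow> sys \<Rightarrow> ('m::finite) \<Rightarrow> real" and xs :: "sys \<Rightarrow> 'm \<Rightarrow> real"
  assumes e: "\<And>j q i. 0 \<le> e j q i" "\<And>j q i. e j q i \<le> \<epsilon>"
    and eps: "0 < \<epsilon>" "\<epsilon> \<le> 1"
    and mu: "0 < mmin" "\<And>i. mmin \<le> mu $ i" "\<And>i. mu $ i \<le> mmax"
    and xs: "\<And>q i. 0 \<le> xs q i" "\<And>i. lam $ i = mu $ i * (\<Sum>q\<in>UNIV. xs q i)"
    and pol: "\<And>q i. marginal e (real_counts z) (pol z i) i \<le> marginal e (real_counts z) q i"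
  shows "drift lam mu pol (\<lambda>z. exp_penalty e (real_counts z)) z \<le>
    mmin * (1 - \<epsilon> / 2) * (exp_penalty e (\<lambda>q i. (1 + 3 * \<epsilon>) * mmax / mmin * xs q i) - exp_penalty e (real_counts z))"
proof -
  let ?\<Phi> = "\<lambda>z. exp_penalty e (real_counts z)"
  let ?g = "marginal e (real_counts z)"
  let ?E = "\<lambda>k. exp (\<Sum>q\<in>UNIV. \<Sum>i\<in>UNIV. e k q i * real (z q i))"
  define \<kappa> where "\<kappa> = (1 + 3 * \<epsilon>) * mmax / mmin"
  have mu_pos: "0 < mu $ i" for i using mu(1) mu(2)[of i] by linarith
  have g: "0 \<le> ?g q i" for q i
    unfolding marginal_def by (intro sum_nonneg mult_nonneg_nonneg e) simp
  have arrivals: "(\<Sum>i\<in>UNIV. lam $ i * (?\<Phi> (incr z (pol z i) i) - ?\<Phi> z))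
    \<le> (\<Sum>i\<in>UNIV. \<Sum>q\<in>UNIV. mmin * (1 - \<epsilon> / 2) * (?g q i * (\<kappa> * xs q i)))"
  proof (rule sum_mono)
    fix i
    have up: "?\<Phi> (incr z (pol z i) i) - ?\<Phi> z \<le> (1 + \<epsilon>) * ?g (pol z i) i"
      unfolding exp_penalty_incr marginal_def sum_distrib_left
    proof (rule sum_mono)
      fix k
      have "?E k * (exp (e k (pol z i) i) - 1) \<le> ?E k * ((1 + \<epsilon>) * e k (pol z i) i)"
        using e eps by (intro mult_left_mono exp_increment_le) auto
      then show "?E k * (exp (e k (pol z i) i) - 1) \<le> (1 + \<epsilon>) * (?E k * e k (pol z i) i)"
        by (simp add: ac_simps)
    qed
    have lam: "0 \<le> lam $ i"
      unfolding xs(2) using mu_pos[of i] by (intro mult_nonneg_nonneg sum_nonneg xs) auto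
    have "lam $ i * (?\<Phi> (incr z (pol z i) i) - ?\<Phi> z) \<le> lam $ i * ((1 + \<epsilon>) * ?g (pol z i) i)"
      using up lam by (rule mult_left_mono)
    also have "\<dots> = (\<Sum>q\<in>UNIV. mu $ i * (1 + \<epsilon>) * (xs q i * ?g (pol z i) i))"
      by (simp add: xs(2) sum_distrib_left sum_distrib_right ac_simps)
    also have "\<dots> \<le> (\<Sum>q\<in>UNIV. mmin * (1 - \<epsilon> / 2) * (?g q i * (\<kappa> * xs q i)))"
    proof (rule sum_mono)
      fix q
      have "mu $ i * (1 + \<epsilon>) \<le> mmax * (1 + \<epsilon>)"
        using mu eps by (intro mult_right_mono) auto
      also have "\<dots> \<le> mmax * ((1 - \<epsilon> / 2) * (1 + 3 * \<epsilon>))"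
      proof (rule mult_left_mono)
        have "\<epsilon> * \<epsilon> \<le> \<epsilon> * 1" using eps by (intro mult_left_mono) auto
        then show "1 + \<epsilon> \<le> (1 - \<epsilon> / 2) * (1 + 3 * \<epsilon>)" by (simp add: algebra_simps)
        show "0 \<le> mmax" using mu_pos[of i] mu(3)[of i] by linarith
      qed
      also have "\<dots> = mmin * (1 - \<epsilon> / 2) * \<kappa>" using mu(1) by (simp add: \<kappa>_def)
      finally have "mu $ i * (1 + \<epsilon>) * (xs q i * ?g (pol z i) i) \<le> mmin * (1 - \<epsilon> / 2) * \<kappa> * (xs q i * ?g q i)"
      proof (rule mult_mono')
        show "xs q i * ?g (pol z i) i \<le> xs q i * ?g q i"
          using pol xs(1) by (rule mult_left_mono)
        show "0 \<le> mu $ i * (1 + \<epsilon>)" using mu_pos[of i] eps by simp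
        show "0 \<le> xs q i * ?g (pol z i) i" using xs(1) g by (rule mult_nonneg_nonneg)
      qed
      then show "mu $ i * (1 + \<epsilon>) * (xs q i * ?g (pol z i) i) \<le> mmin * (1 - \<epsilon> / 2) * (?g q i * (\<kappa> * xs q i))"
        by (simp add: ac_simps)
    qed
    finally show "lam $ i * (?\<Phi> (incr z (pol z i) i) - ?\<Phi> z) \<le>
      (\<Sum>q\<in>UNIV. mmin * (1 - \<epsilon> / 2) * (?g q i * (\<kappa> * xs q i)))" .
  qed
  have departures: "(\<Sum>q\<in>UNIV. \<Sum>i\<in>UNIV. mu $ i * real (z q i) * (?\<Phi> (decr z q i) - ?\<Phi> z))
    \<le> (\<Sum>q\<in>UNIV. \<Sum>i\<in>UNIV. - (mmin * (1 - \<epsilon> / 2) * (?g q i * real (z q i))))"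
  proof (intro sum_mono)
    fix q i
    show "mu $ i * real (z q i) * (?\<Phi> (decr z q i) - ?\<Phi> z) \<le> - (mmin * (1 - \<epsilon> / 2) * (?g q i * real (z q i)))"
    proof (cases "z q i = 0")
      case False
      have "?\<Phi> (decr z q i) - ?\<Phi> z \<le> - (1 - \<epsilon> / 2) * ?g q i"
        unfolding exp_penalty_decr[of z q i, OF False[unfolded neq0_conv]] marginal_def sum_distrib_left
      proof (rule sum_mono)
        fix k
        have "?E k * (exp (- e k q i) - 1) \<le> ?E k * (- (1 - \<epsilon> / 2) * e k q i)"
          using e by (intro mult_left_mono exp_decrement_le) auto
        then show "?E k * (exp (- e k q i) - 1) \<le> - (1 - \<epsilon> / 2) * (?E k * e k q i)"
          by (simp add: algebra_simps)
      qed
      then have "mu $ i * real (z q i) * (?\<Phi> (decr z q i) - ?\<Phi> z) \<le> mu $ i * real (z q i) * (- (1 - \<epsilon> / 2) * ?g q i)"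
        using mu_pos[of i] by (intro mult_left_mono) auto
      also have "\<dots> = - (mu $ i * ((1 - \<epsilon> / 2) * (?g q i * real (z q i))))" by (simp add: algebra_simps)
      also have "\<dots> \<le> - (mmin * ((1 - \<epsilon> / 2) * (?g q i * real (z q i))))"
        using mu(2)[of i] eps g[of q i] by (intro le_imp_neg_le mult_right_mono) auto
      finally show ?thesis by (simp add: mult.assoc)
    qed simp
  qed
  have "drift lam mu pol ?\<Phi> z \<le>
    (\<Sum>q\<in>UNIV. \<Sum>i\<in>UNIV. mmin * (1 - \<epsilon> / 2) * (?g q i * (\<kappa> * xs q i))) +
    (\<Sum>q\<in>UNIV. \<Sum>i\<in>UNIV. - (mmin * (1 - \<epsilon> / 2) * (?g q i * real (z q i))))"
    unfolding drift_def using add_mono[OF arrivals departures]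
    by (subst sum.swap[of _ UNIV UNIV]) simp
  also have "\<dots> = mmin * (1 - \<epsilon> / 2) * (\<Sum>q\<in>UNIV. \<Sum>i\<in>UNIV. ?g q i * (\<kappa> * xs q i - real (z q i)))"
    by (simp add: sum_distrib_left sum.distrib[symmetric] algebra_simps)
  also have "\<dots> \<le> mmin * (1 - \<epsilon> / 2) * (exp_penalty e (\<lambda>q i. \<kappa> * xs q i) - exp_penalty e (real_counts z))"
    using mu(1) eps by (intro mult_left_mono exp_penalty_convex mult_nonneg_nonneg) auto
  finally show ?thesis unfolding \<kappa>_def .
qed

section \<open>The penalty policy\<close>

definition coords :: "(real^'m) \<times> (real^'m) \<Rightarrow> sys \<Rightarrow> 'm \<Rightarrow> real" where
  "coords p q i = (case q of Original \<Rightarrow> fst p $ i | Fictitious \<Rightarrow> snd p $ i)"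

text \<open>
  The coefficients of the linear exponents of \<open>penalty\<close>, including the multiplier \<open>\<beta>\<close>: with them
  \<open>penalty\<close> is an instance of \<open>exp_penalty\<close>.
\<close>

definition exponent ::
    "real \<Rightarrow> real^'m^'s \<Rightarrow> real^'s \<Rightarrow> real^'m \<Rightarrow> 's \<Rightarrow> sys \<Rightarrow> 'm \<Rightarrow> real" where
  "exponent \<beta> D h \<rho> j q i =
     \<beta> * ((case q of Original \<Rightarrow> pos_part D | Fictitious \<Rightarrow> neg_part D) $ j $ i / capacity D h \<rho> j)"

lemma sum_sys: "(\<Sum>q\<in>UNIV. f q) = f Original + f Fictitious"
proof -
  have *: "(UNIV :: sys set) = {Original, Fictitious}" using sys.exhaust by blast
  show ?thesis by (subst *) simp
qed

lemma utilization_eq: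
  "\<beta> * utilization D h \<rho> p j = (\<Sum>q\<in>UNIV. \<Sum>i\<in>UNIV. exponent \<beta> D h \<rho> j q i * coords p q i)"
  by (simp add: utilization_def sum_sys exponent_def coords_def matrix_vector_mult_def
      sum_distrib_left sum_divide_distrib add_divide_distrib distrib_left ac_simps)

lemma penalty_eq: "penalty \<beta> D h \<rho> p = exp_penalty (exponent \<beta> D h \<rho>) (coords p)"
  by (simp add: penalty_def exp_penalty_def utilization_eq)

lemma has_derivative_penalty_coordinate:
  assumes "\<And>u p' j'. coords (p u) p' j' = coords p0 p' j' + (if p' = q \<and> j' = i then u else 0)"
  shows "((\<lambda>u. penalty \<beta> D h \<rho> (p u)) has_real_derivative
    marginal (exponent \<beta> D h \<rho>) (coords p0) q i) (at 0)"
proof -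
  let ?e = "exponent \<beta> D h \<rho>"
  have eq: "penalty \<beta> D h \<rho> (p u) = (\<Sum>j\<in>UNIV. exp ((\<Sum>q\<in>UNIV. \<Sum>i\<in>UNIV. ?e j q i * coords p0 q i) + u * ?e j q i))" for u
    unfolding penalty_eq exp_penalty_def by (intro sum.cong refl arg_cong[where f=exp] linear_shift assms)
  show ?thesis
    unfolding eq marginal_def by (auto intro!: derivative_eq_intros)
qed

lemma partial_x_penalty:
  "partial_x (penalty \<beta> D h \<rho>) p i = marginal (exponent \<beta> D h \<rho>) (coords p) Original i"
  unfolding partial_x_def
  by (rule DERIV_imp_deriv, rule has_derivative_penalty_coordinate)
     (auto simp: coords_def axis_def split: sys.split)

lemma partial_y_penalty:
  "partial_y (penalty \<beta> D h \<rho>) p i = marginal (exponent \<beta> D h \<rho>) (coords p) Fictitious i"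
  unfolding partial_y_def
  by (rule DERIV_imp_deriv, rule has_derivative_penalty_coordinate)
     (auto simp: coords_def axis_def split: sys.split)

lemma coords_state:
  "coords (state W N R t \<omega>) = real_counts (\<lambda>q i. num_present W N R q i t \<omega>)"
  "coords (state_before W N R t \<omega>) = real_counts (\<lambda>q i. num_before W N R q i t \<omega>)"
  by (auto simp: fun_eq_iff coords_def state_def state_before_def split: sys.split)

text \<open>
  For \<open>0 \<le> x \<le> \<rho>\<close> the value of a row of \<open>D\<close> at \<open>x\<close> is at least minus its negative part at \<open>\<rho>\<close>, so
  a strict inequality at \<open>x\<close> makes the capacity positive.
\<close>

lemma capacity_pos:
  assumes "x \<in> target_set D h \<rho>" "(D *v x) $ j < h $ j"
  shows "0 < capacity D h \<rho> j"
proof -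
  have "- (\<Sum>i\<in>UNIV. max (- D $ j $ i) 0 * \<rho> $ i) \<le> (\<Sum>i\<in>UNIV. D $ j $ i * x $ i)"
    unfolding sum_negf[symmetric]
  proof (rule sum_mono)
    fix i
    have x: "0 \<le> x $ i" "x $ i \<le> \<rho> $ i" using assms(1) by (auto simp: target_set_def)
    have "max (- D $ j $ i) 0 * x $ i \<le> max (- D $ j $ i) 0 * \<rho> $ i"
      using x by (intro mult_left_mono) auto
    moreover have "- (max (- D $ j $ i) 0 * x $ i) \<le> D $ j $ i * x $ i"
    proof (cases "0 \<le> D $ j $ i")
      case True
      then show ?thesis using x by (simp add: max_def)
    next
      case False
      then show ?thesis by (simp add: max_def)
    qed
    ultimately show "- (max (- D $ j $ i) 0 * \<rho> $ i) \<le> D $ j $ i * x $ i" by linarith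
  qed
  also have "\<dots> < h $ j" using assms(2) by (simp add: matrix_vector_mult_def)
  finally show ?thesis by (simp add: capacity_def neg_part_def matrix_vector_mult_def)
qed

text \<open>
  The bound on \<open>\<beta>\<close> says that one request changes each exponent by at most \<open>\<epsilon>\<close>.
\<close>

lemma exponent_bounds:
  assumes D: "\<And>j i. \<bar>D $ j $ i\<bar> \<le> 1" and cap: "\<And>j. 0 < capacity D h \<rho> j"
    and \<beta>: "0 \<le> \<beta>" "\<beta> \<le> \<epsilon> * Min (range (capacity D h \<rho>))" and \<epsilon>: "0 < \<epsilon>"
  shows "0 \<le> exponent \<beta> D h \<rho> j q i" "exponent \<beta> D h \<rho> j q i \<le> \<epsilon>"
proof -
  define a where "a = (case q of Original \<Rightarrow> pos_part D | Fictitious \<Rightarrow> neg_part D) $ j $ i"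
  have a: "0 \<le> a" "a \<le> 1"
    using D[of j i] by (auto simp: a_def pos_part_def neg_part_def split: sys.split)
  have "Min (range (capacity D h \<rho>)) \<le> capacity D h \<rho> j" by (rule Min_le) auto
  then have "\<epsilon> * Min (range (capacity D h \<rho>)) \<le> \<epsilon> * capacity D h \<rho> j"
    using \<epsilon> by (intro mult_left_mono) auto
  then have le: "\<beta> \<le> \<epsilon> * capacity D h \<rho> j" using \<beta>(2) by linarith
  show "0 \<le> exponent \<beta> D h \<rho> j q i"
    using \<beta>(1) a(1) cap[of j] by (simp add: exponent_def a_def[symmetric])
  have "\<beta> * a \<le> \<beta> * 1" using \<beta>(1) a(2) by (intro mult_left_mono)
  then have "\<beta> * a \<le> \<epsilon> * capacity D h \<rho> j" using le by linarith
  then show "exponent \<beta> D h \<rho> j q i \<le> \<epsilon>"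
    using cap[of j] by (simp add: exponent_def a_def[symmetric] pos_divide_le_eq)
qed

theorem theorem8:
  fixes lam mu \<rho> xs ys :: "real^'m"
    and D :: "real^'m^'s" and h :: "real^'s"
    and \<beta> \<epsilon> \<gamma> mu_min mu_max \<Psi>s :: real
    and \<Psi> :: "(real^'m) \<times> (real^'m) \<Rightarrow> real"
    and M :: "'a measure"
    and W :: "'m clock \<Rightarrow> 'a \<Rightarrow> real"
    and N :: "'a \<Rightarrow> sys \<Rightarrow> 'm \<Rightarrow> nat"
    and R :: "'m \<Rightarrow> nat \<Rightarrow> 'a \<Rightarrow> sys"
  assumes lam_pos: "\<And>i. 0 < lam $ i" and mu_pos: "\<And>i. 0 < mu $ i"
    and rho: "\<rho> = offered_load lam mu"
    and h_nonneg: "\<And>j. 0 \<le> h $ j"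
    and D_normalized: "\<And>j i. \<bar>D $ j $ i\<bar> \<le> 1"
    and interior: "\<exists>x \<in> target_set D h \<rho>. \<forall>j. (D *v x) $ j < h $ j"
    and minimizer: "is_arg_min (max_utilization D h \<rho>)
                      (\<lambda>(x, y). (x, y) \<in> lifted_set D h \<rho> \<and> x + y = \<rho>) (xs, ys)"
    and gamma: "\<gamma> = max_utilization D h \<rho> (xs, ys)"
    and mu_min: "mu_min = Min (range (\<lambda>i. mu $ i))"
    and mu_max: "mu_max = Max (range (\<lambda>i. mu $ i))"
    and eps: "0 < \<epsilon>" "\<epsilon> < 1 / 4"
    and beta_nonneg: "0 \<le> \<beta>"
    and beta_le: "\<beta> \<le> \<epsilon> * Min (range (capacity D h \<rho>))"
    and ratio: "\<gamma> \<le> mu_min / mu_max"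
    and Psi: "\<Psi> = penalty \<beta> D h \<rho>"
    and Psi_star: "\<Psi>s = \<Psi> (((1 + 3 * \<epsilon>) * mu_max / mu_min) *\<^sub>R (xs, ys))"
    and clocks: "driving_clocks M lam mu W N"
    and policy: "follows_policy M \<Psi> W N R"
    and initial: "(\<integral>\<^sup>+ \<omega>. ennreal (\<Psi> (state W N R 0 \<omega>)) \<partial>M) \<le> ennreal \<Psi>s"
  shows "\<forall>t\<ge>0. (\<integral>\<^sup>+ \<omega>. ennreal (\<Psi> (state W N R t \<omega>)) \<partial>M) \<le> ennreal \<Psi>s"
proof (intro allI impI)
  fix t :: real assume t: "0 \<le> t"
  define e where "e = exponent \<beta> D h \<rho>"
  define xys where "xys = coords (xs, ys)"
  define pol where "pol z i = (if marginal e (real_counts z) Original i \<le> marginal e (real_counts z) Fictitious i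
      then Original else Fictitious)" for z :: "'m counts" and i
  let ?\<Phi> = "\<lambda>z :: 'm counts. exp_penalty e (real_counts z)"
  obtain x where x: "x \<in> target_set D h \<rho>" "\<forall>j. (D *v x) $ j < h $ j"
    using interior by blast
  then have cap: "0 < capacity D h \<rho> j" for j by (auto intro: capacity_pos)
  have e: "0 \<le> e j q i" "e j q i \<le> \<epsilon>" for j q i
    unfolding e_def by (rule exponent_bounds[OF D_normalized cap beta_nonneg beta_le eps(1)])+
  have min_in: "mu_min \<in> range (\<lambda>i. mu $ i)" unfolding mu_min by (rule Min_in) auto
  have mu: "0 < mu_min" "mu_min \<le> mu $ i" "mu $ i \<le> mu_max" for i
    using min_in mu_pos by (auto simp: mu_min mu_max)
  have opt: "(xs, ys) \<in> lifted_set D h \<rho>" "xs + ys = \<rho>"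
    using minimizer by (auto simp: is_arg_min_def)
  have xys_nonneg: "0 \<le> xys q i" for q i
    using opt(1) by (auto simp: xys_def coords_def lifted_set_def split: sys.split)
  have balance: "lam $ i = mu $ i * (\<Sum>q\<in>UNIV. xys q i)" for i
  proof -
    have "xs $ i + ys $ i = lam $ i / mu $ i"
      using opt(2) by (auto simp: rho offered_load_def vec_eq_iff)
    then show ?thesis using mu_pos[of i] by (simp add: sum_sys xys_def coords_def)
  qed
  have star: "\<Psi>s = exp_penalty e (\<lambda>q i. (1 + 3 * \<epsilon>) * mu_max / mu_min * xys q i)"
  proof -
    have "coords (r *\<^sub>R (xs, ys)) = (\<lambda>q i. r * xys q i)" for r
      by (auto simp: fun_eq_iff coords_def xys_def split: sys.split)
    then show ?thesis by (simp add: Psi_star Psi penalty_eq e_def)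
  qed
  have state: "\<Psi> (state W N R s \<omega>) = ?\<Phi> (\<lambda>q i. num_present W N R q i s \<omega>)" for s \<omega>
    by (simp add: Psi penalty_eq coords_state e_def)
  have nonneg: "0 \<le> exp_penalty e y" for y
    unfolding exp_penalty_def by (intro sum_nonneg) simp
  have "(\<integral>\<^sup>+\<omega>. ennreal (?\<Phi> (\<lambda>q i. num_present W N R q i t \<omega>)) \<partial>M) \<le> ennreal \<Psi>s"
  proof (rule lyapunov_bound[OF lam_pos mu_pos clocks _ _ _ _ _ _ _ t])
    show "AE \<omega> in M. \<forall>i n. R i n \<omega> = pol (\<lambda>q j. num_before W N R q j (arrival_time W i n \<omega>) \<omega>) i"
      using policy
      by (simp add: follows_policy_def Psi partial_x_penalty partial_y_penalty coords_state pol_def e_def Let_def)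
    show "0 < mu_min * (1 - \<epsilon> / 2)" using mu(1) eps by simp
    show "0 \<le> \<Psi>s" unfolding star by (rule nonneg)
    show "?\<Phi> z \<le> ?\<Phi> (incr z q i)" for z q i
    proof -
      have "0 \<le> ?\<Phi> (incr z q i) - ?\<Phi> z"
        unfolding exp_penalty_incr using e(1) by (intro sum_nonneg mult_nonneg_nonneg) simp_all
      then show ?thesis by simp
    qed
    show "drift lam mu pol ?\<Phi> z \<le> mu_min * (1 - \<epsilon> / 2) * (\<Psi>s - ?\<Phi> z)" for z
      unfolding star
    proof (rule exp_penalty_drift[OF e eps(1) _ mu xys_nonneg balance])
      show "\<epsilon> \<le> 1" using eps by simp
      show "marginal e (real_counts z) (pol z i) i \<le> marginal e (real_counts z) q i" for q i
        by (cases q) (simp_all add: pol_def)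
    qed
    show "(\<integral>\<^sup>+\<omega>. ennreal (?\<Phi> (\<lambda>q i. num_present W N R q i 0 \<omega>)) \<partial>M) \<le> ennreal \<Psi>s"
      using initial by (simp add: state)
  qed (rule nonneg)
  then show "(\<integral>\<^sup>+ \<omega>. ennreal (\<Psi> (state W N R t \<omega>)) \<partial>M) \<le> ennreal \<Psi>s"
    by (simp add: state)
qed

end
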